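(* Let $s\ge1$ be an integer and $\beta>0$. Let $\phi:\{\pm1\}\times\mathbb{R}\to\mathbb{R}_+$ be any strictly proper composite binary loss with underlying (invertible) link function $\gamma$ on $[0,1]$, and let $\psi:\{0,1\}^s\times\mathbb{R}^{s^2+1}\to\mathbb{R}_+$ and $\mathrm{decode}:\mathbb{R}^{s^2+1}\to\{0,1\}^s$ be the surrogate loss and decoding map built from $(\phi,\gamma)$ as defined in the context. Then $(\psi,\mathrm{decode})$ is $\mathbf{L}^{F_\beta}$-calibrated. That is, for every probability distribution $D$ on $\mathcal{X}\times\{0,1\}^s$ and every sequence of (random) models $\mathbf{f}_S:\mathcal{X}\to\mathbb{R}^{s^2+1}$ learned from training samples $S\sim D^m$ of increasing size $m$, if $\mathrm{regret}_D^{\psi}[\mathbf{f}_S]\to0$ in probability as $m\to\infty$, then $\mathrm{regret}_D^{\mathbf{L}^{F_\beta}}[\mathrm{decode}\circ\mathbf{f}_S]\to0$ in probability as $m\to\infty$.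
   Context: $\mathcal{X}$ is an instance space (a measurable space); all functions are assumed measurable. $\mathbf{1}(\cdot)$ denotes the indicator, and for $\mathbf{y}\in\{0,1\}^s$, $\|\mathbf{y}\|_1=\sum_{j=1}^s y_j$. **$F_\beta$-loss and regret.** For $\mathbf{y},\hat{\mathbf{y}}\in\{0,1\}^s$, $$F_\beta(\mathbf{y},\hat{\mathbf{y}})=\frac{(1+\beta^2)\sum_{j=1}^s y_j\hat y_j}{\beta^2\|\mathbf{y}\|_1+\|\hat{\mathbf{y}}\|_1},$$ with the convention $\frac00=1$, so $F_\beta(\mathbf{0},\mathbf{0})=1$. The loss matrix $\mathbf{L}^{F_\beta}$ has entries $\ell^{F_\beta}_{\mathbf{y},\hat{\mathbf{y}}}=1-F_\beta(\mathbf{y},\hat{\mathbf{y}})$. For $\mathbf{h}:\mathcal{X}\to\{0,1\}^s$, $\mathrm{er}_D^{\mathbf{L}^{F_\beta}}[\mathbf{h}]=\mathbf{E}_{(x,\mathbf{y})\sim D}[\ell^{F_\beta}_{\mathbf{y},\mathbf{h}(x)}]$ and $\mathrm{regret}_D^{\mathbf{L}^{F_\beta}}[\mathbf{h}]=\mathrm{er}_D^{\mathbf{L}^{F_\beta}}[\mathbf{h}]-\inf_{\mathbf{h}':\mathcal{X}\to\{0,1\}^s}\mathrm{er}_D^{\mathbf{L}^{F_\beta}}[\mathbf{h}']$. **Link functions and strictly proper composite losses.** A link function is an injective map $\gamma$ on $[0,1]$ whose inverse $\gamma^{-1}(u)\in[0,1]$ is defined for every $u\in\mathbb{R}$. The values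 of $\gamma$ are real, except that $\gamma(0),\gamma(1)$ may be infinite (as for the logit link $\gamma(p)=\ln\frac{p}{1-p}$). In that case $\phi(y,\pm\infty)\in[0,\infty]$ denotes the limit of $\phi(y,u)$ as $u\to\pm\infty$ (assumed to exist), with $0\cdot\infty=0$. For $q\in[0,1]$, $y\sim\mathrm{Bin}^{\pm1}(q)$ means $y=+1$ with probability $q$ and $y=-1$ with probability $1-q$. A binary loss $\phi:\{\pm1\}\times\mathbb{R}\to\mathbb{R}_+$ is strictly proper composite with underlying link $\gamma$ if for all $q\in[0,1]$ and all $u\in\mathbb{R}$ with $u\ne\gamma(q)$, $$\mathbf{E}_{y\sim\mathrm{Bin}^{\pm1}(q)}\big[\phi(y,u)-\phi(y,\gamma(q))\big]>0.$$ **Surrogate and decoding.** For $\mathbf{y},\hat{\mathbf{y}}\in\{0,1\}^s$ and $j,k\in\{1,\dots,s\}$ let $$a_{\mathbf{y},0}=\mathbf{1}(\|\mathbf{y}\|_1=0),\quad b_{\hat{\mathbf{y}},0}=-\mathbf{1}(\|\hat{\mathbf{y}}\|_1=0),\quad a_{\mathbf{y},jk}=\mathbf{1}(\|\mathbf{y}\|_1=k)\,y_j,\quad b_{\hat{\mathbf{y}},jk}=-\frac{(1+\beta^2)\hat y_j}{\beta^2k+\|\hat{\mathbf{y}}\|_1}.$$ Write $\mathbf{u}=(u_0,(u_{jk})_{j,k=1}^s)\in\mathbb{R}^{s^2+1}$. Define $$\psi(\mathbf{y},\mathbf{u})=a_{\mathbf{y},0}\phi(+1,u_0)+(1-a_{\mathbf{y},0})\phi(-1,u_0)+\sum_{j=1}^s\sum_{k=1}^s\Big(a_{\mathbf{y},jk}\phi(+1,u_{jk})+(1-a_{\mathbf{y},jk})\phi(-1,u_{jk})\Big),$$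 $$\mathrm{decode}(\mathbf{u})\in\operatorname*{argmin}_{\hat{\mathbf{y}}\in\{0,1\}^s}\; b_{\hat{\mathbf{y}},0}\,\gamma^{-1}(u_0)+\sum_{j=1}^s\sum_{k=1}^s b_{\hat{\mathbf{y}},jk}\,\gamma^{-1}(u_{jk}),$$ with ties broken by any fixed (measurable) rule. **Surrogate regret.** $\mathrm{er}_D^\psi[\mathbf{f}]=\mathbf{E}_{(x,\mathbf{y})\sim D}[\psi(\mathbf{y},\mathbf{f}(x))]$ and $\mathrm{regret}_D^\psi[\mathbf{f}]=\mathrm{er}_D^\psi[\mathbf{f}]-\inf_{\mathbf{f}':\mathcal{X}\to\mathbb{R}^{s^2+1}}\mathrm{er}_D^\psi[\mathbf{f}']$ (equal to $+\infty$ if $\mathrm{er}_D^\psi[\mathbf{f}]=+\infty$). *)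

theory Defs
  imports "HOL-Probability.Probability"
begin

section \<open>Strictly proper composite binary losses\<close>

text \<open>A link is only relevant on \<open>{0..1}\<close>. It is \<open>ereal\<close>-valued because \<open>\<gamma> 0\<close> and \<open>\<gamma> 1\<close> may be
  infinite, as for the logit link.\<close>

definition link_function :: "(real \<Rightarrow> ereal) \<Rightarrow> bool" where
  "link_function \<gamma> \<longleftrightarrow>
     inj_on \<gamma> {0..1} \<and>
     (\<forall>u::real. ereal u \<in> \<gamma> ` {0..1}) \<and>
     (\<forall>p\<in>{0<..<1}. \<bar>\<gamma> p\<bar> \<noteq> \<infinity>) \<and>
     \<gamma> \<in> borel_measurable (restrict_space borel {0..1})"

definition link_inv :: "(real \<Rightarrow> ereal) \<Rightarrow> real \<Rightarrow> real" where
  "link_inv \<gamma> u = the_inv_into {0..1} \<gamma> (ereal u)"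

text \<open>Binary labels are the integers \<open>1\<close> and \<open>-1\<close>; values of \<open>\<phi>\<close> at other integers are irrelevant.\<close>

definition binary_loss :: "(int \<Rightarrow> real \<Rightarrow> real) \<Rightarrow> bool" where
  "binary_loss \<phi> \<longleftrightarrow> (\<forall>y\<in>{-1, 1}. \<phi> y \<in> borel_measurable borel \<and> (\<forall>u. 0 \<le> \<phi> y u))"

definition loss_ext :: "(int \<Rightarrow> real \<Rightarrow> real) \<Rightarrow> int \<Rightarrow> ereal \<Rightarrow> ereal" where
  "loss_ext \<phi> y v =
     (if v = \<infinity> then Lim at_top (\<lambda>u. ereal (\<phi> y u))
      else if v = -\<infinity> then Lim at_bot (\<lambda>u. ereal (\<phi> y u))
      else ereal (\<phi> y (real_of_ereal v)))"

text \<open>The last condition writes out the expectation over a label that is \<open>1\<close> with probability \<open>q\<close>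
  and \<open>-1\<close> otherwise. On \<open>ereal\<close> a zero weight annihilates an infinite loss difference. The limits
  of the loss are required to exist only at infinite values that the link takes.\<close>

definition strictly_proper_composite :: "(int \<Rightarrow> real \<Rightarrow> real) \<Rightarrow> (real \<Rightarrow> ereal) \<Rightarrow> bool" where
  "strictly_proper_composite \<phi> \<gamma> \<longleftrightarrow>
     binary_loss \<phi> \<and> link_function \<gamma> \<and>
     (\<infinity> \<in> \<gamma> ` {0..1} \<longrightarrow> (\<forall>y\<in>{-1, 1}. \<exists>l. ((\<lambda>u. ereal (\<phi> y u)) \<longlongrightarrow> l) at_top)) \<and>
     (-\<infinity> \<in> \<gamma> ` {0..1} \<longrightarrow> (\<forall>y\<in>{-1, 1}. \<exists>l. ((\<lambda>u. ereal (\<phi> y u)) \<longlongrightarrow> l) at_bot)) \<and>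
     (\<forall>q\<in>{0..1}. \<forall>u::real. ereal u \<noteq> \<gamma> q \<longrightarrow>
        ereal q * (ereal (\<phi> 1 u) - loss_ext \<phi> 1 (\<gamma> q)) +
        ereal (1 - q) * (ereal (\<phi> (-1) u) - loss_ext \<phi> (-1) (\<gamma> q)) > 0)"


section \<open>Regrets and calibration\<close>

definition loss_er :: "('x \<times> 'y) measure \<Rightarrow> ('y \<Rightarrow> 'y \<Rightarrow> real) \<Rightarrow> ('x \<Rightarrow> 'y) \<Rightarrow> real" where
  "loss_er D L h = (\<integral>(x, y). L y (h x) \<partial>D)"

definition loss_regret ::
  "'x measure \<Rightarrow> 'y set \<Rightarrow> ('x \<times> 'y) measure \<Rightarrow> ('y \<Rightarrow> 'y \<Rightarrow> real) \<Rightarrow> ('x \<Rightarrow> 'y) \<Rightarrow> real" where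
  "loss_regret X Y D L h = loss_er D L h - (INF h' \<in> X \<rightarrow>\<^sub>M count_space Y. loss_er D L h')"

definition surrogate_er ::
  "('x \<times> 'y) measure \<Rightarrow> ('y \<Rightarrow> 'u \<Rightarrow> real) \<Rightarrow> ('x \<Rightarrow> 'u) \<Rightarrow> ennreal" where
  "surrogate_er D \<psi> f = (\<integral>\<^sup>+(x, y). ennreal (\<psi> y (f x)) \<partial>D)"

text \<open>On \<open>ennreal\<close>, \<open>\<infinity> - c = \<infinity>\<close> for every \<open>c\<close>, so a model of infinite error has infinite regret.\<close>

definition surrogate_regret ::
  "'x measure \<Rightarrow> 'u measure \<Rightarrow> ('x \<times> 'y) measure \<Rightarrow> ('y \<Rightarrow> 'u \<Rightarrow> real) \<Rightarrow> ('x \<Rightarrow> 'u) \<Rightarrow> ennreal" where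
  "surrogate_regret X U D \<psi> f = surrogate_er D \<psi> f - (INF f' \<in> X \<rightarrow>\<^sub>M U. surrogate_er D \<psi> f')"

text \<open>Convergence to zero in probability, where the \<open>m\<close>-th variable lives on its own probability
  space \<open>P m\<close>.\<close>

definition tendsto_zero_in_prob :: "(nat \<Rightarrow> 'w measure) \<Rightarrow> (nat \<Rightarrow> 'w \<Rightarrow> ereal) \<Rightarrow> bool" where
  "tendsto_zero_in_prob P Z \<longleftrightarrow>
     (\<forall>\<epsilon>>0. (\<lambda>m. measure (P m) {w \<in> space (P m). \<bar>Z m w\<bar> > ereal \<epsilon>}) \<longlonglongrightarrow> 0)"

text \<open>The randomness of a learner given \<open>m\<close> examples: an i.i.d. sample from \<open>D\<close> and an independent
  internal seed drawn from \<open>R\<close>. Deterministic learners ignore the seed.\<close>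

definition training_space :: "'z measure \<Rightarrow> 'r measure \<Rightarrow> nat \<Rightarrow> ((nat \<Rightarrow> 'z) \<times> 'r) measure" where
  "training_space D R m = (\<Pi>\<^sub>M i\<in>{..<m}. D) \<Otimes>\<^sub>M R"

text \<open>\<open>U\<close> is the space of scores and \<open>dec\<close> maps scores to labels in \<open>Y\<close>; \<open>f m (S, r)\<close> is the model
  learned from the sample \<open>S\<close> of size \<open>m\<close> with seed \<open>r\<close>. The first argument only fixes the type of
  seeds.\<close>

definition calibrated ::
  "'r itself \<Rightarrow> 'x measure \<Rightarrow> 'y set \<Rightarrow> 'u measure \<Rightarrow>
   ('y \<Rightarrow> 'y \<Rightarrow> real) \<Rightarrow> ('y \<Rightarrow> 'u \<Rightarrow> real) \<Rightarrow> ('u \<Rightarrow> 'y) \<Rightarrow> bool" where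
  "calibrated T X Y U L \<psi> dec \<longleftrightarrow>
     (\<forall>(D :: ('x \<times> 'y) measure) (R :: nat \<Rightarrow> 'r measure)
       (f :: nat \<Rightarrow> (nat \<Rightarrow> 'x \<times> 'y) \<times> 'r \<Rightarrow> 'x \<Rightarrow> 'u).
       prob_space D \<longrightarrow> sets D = sets (X \<Otimes>\<^sub>M count_space Y) \<longrightarrow>
       (\<forall>m. prob_space (R m)) \<longrightarrow>
       (\<forall>m. (\<lambda>(w, x). f m w x) \<in> training_space D (R m) m \<Otimes>\<^sub>M X \<rightarrow>\<^sub>M U) \<longrightarrow>
       tendsto_zero_in_prob (\<lambda>m. training_space D (R m) m)
         (\<lambda>m w. enn2ereal (surrogate_regret X U D \<psi> (f m w))) \<longrightarrow>
       tendsto_zero_in_prob (\<lambda>m. training_space D (R m) m)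
         (\<lambda>m w. ereal (loss_regret X Y D L (dec \<circ> f m w))))"


section \<open>The F-beta loss, its surrogate and the decoding\<close>

definition labels :: "nat \<Rightarrow> (nat \<Rightarrow> nat) set" where
  "labels s = {1..s} \<rightarrow>\<^sub>E {0, 1}"

definition norm1 :: "nat \<Rightarrow> (nat \<Rightarrow> nat) \<Rightarrow> nat" where
  "norm1 s y = (\<Sum>j=1..s. y j)"

definition F_measure :: "nat \<Rightarrow> real \<Rightarrow> (nat \<Rightarrow> nat) \<Rightarrow> (nat \<Rightarrow> nat) \<Rightarrow> real" where
  "F_measure s \<beta> y z =
     (let d = \<beta>\<^sup>2 * real (norm1 s y) + real (norm1 s z)
      in if d = 0 then 1 else (1 + \<beta>\<^sup>2) * (\<Sum>j=1..s. real (y j) * real (z j)) / d)"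

definition F_loss :: "nat \<Rightarrow> real \<Rightarrow> (nat \<Rightarrow> nat) \<Rightarrow> (nat \<Rightarrow> nat) \<Rightarrow> real" where
  "F_loss s \<beta> y z = 1 - F_measure s \<beta> y z"

text \<open>A score vector of dimension \<open>s\<^sup>2 + 1\<close> is the pair of \<open>u\<^sub>0\<close> and the family of all \<open>u\<^sub>j\<^sub>k\<close>.\<close>

type_synonym score = "real \<times> (nat \<times> nat \<Rightarrow> real)"

definition scores :: "nat \<Rightarrow> score measure" where
  "scores s = borel \<Otimes>\<^sub>M (\<Pi>\<^sub>M jk\<in>{1..s} \<times> {1..s}. borel)"

definition coeff_a0 :: "nat \<Rightarrow> (nat \<Rightarrow> nat) \<Rightarrow> real" where
  "coeff_a0 s y = of_bool (norm1 s y = 0)"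

definition coeff_a :: "nat \<Rightarrow> (nat \<Rightarrow> nat) \<Rightarrow> nat \<Rightarrow> nat \<Rightarrow> real" where
  "coeff_a s y j k = of_bool (norm1 s y = k) * real (y j)"

definition coeff_b0 :: "nat \<Rightarrow> (nat \<Rightarrow> nat) \<Rightarrow> real" where
  "coeff_b0 s z = - of_bool (norm1 s z = 0)"

definition coeff_b :: "nat \<Rightarrow> real \<Rightarrow> (nat \<Rightarrow> nat) \<Rightarrow> nat \<Rightarrow> nat \<Rightarrow> real" where
  "coeff_b s \<beta> z j k = - ((1 + \<beta>\<^sup>2) * real (z j) / (\<beta>\<^sup>2 * real k + real (norm1 s z)))"

definition surrogate :: "nat \<Rightarrow> (int \<Rightarrow> real \<Rightarrow> real) \<Rightarrow> (nat \<Rightarrow> nat) \<Rightarrow> score \<Rightarrow> real" where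
  "surrogate s \<phi> y u =
     coeff_a0 s y * \<phi> 1 (fst u) + (1 - coeff_a0 s y) * \<phi> (-1) (fst u) +
     (\<Sum>j=1..s. \<Sum>k=1..s.
        coeff_a s y j k * \<phi> 1 (snd u (j, k)) + (1 - coeff_a s y j k) * \<phi> (-1) (snd u (j, k)))"

definition decode_objective ::
  "nat \<Rightarrow> real \<Rightarrow> (real \<Rightarrow> ereal) \<Rightarrow> score \<Rightarrow> (nat \<Rightarrow> nat) \<Rightarrow> real" where
  "decode_objective s \<beta> \<gamma> u z =
     coeff_b0 s z * link_inv \<gamma> (fst u) +
     (\<Sum>j=1..s. \<Sum>k=1..s. coeff_b s \<beta> z j k * link_inv \<gamma> (snd u (j, k)))"

definition is_decoding :: "nat \<Rightarrow> real \<Rightarrow> (real \<Rightarrow> ereal) \<Rightarrow> (score \<Rightarrow> nat \<Rightarrow> nat) \<Rightarrow> bool" where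
  "is_decoding s \<beta> \<gamma> dec \<longleftrightarrow>
     dec \<in> scores s \<rightarrow>\<^sub>M count_space (labels s) \<and>
     (\<forall>u\<in>space (scores s).
        is_arg_min (decode_objective s \<beta> \<gamma> u) (\<lambda>z. z \<in> labels s) (dec u))"

end

theory Submission
  imports Defs
begin

text \<open>Conditioning on the instance turns both errors into sums over the coordinates of a score vector:
  the conditional target loss of a labelling is \<open>1 + \<Sum>\<^sub>i b\<^sub>i q\<^sub>i\<close> and the conditional surrogate loss is
  the sum of the binary risks at the label probabilities \<open>q\<^sub>i\<close>, the conditional means of the \<open>a\<^sub>i\<close>.
  If every \<open>\<gamma>\<inverse>(u\<^sub>i)\<close> is within \<open>\<epsilon>\<close> of \<open>q\<^sub>i\<close>, decoding loses only \<open>O(\<epsilon>)\<close>. Otherwise some coordinate can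
  be replaced by a value from a fixed finite set that lowers its binary risk by a uniform \<open>\<delta>\<close>, so
  the surrogate regret is at least \<open>\<delta>\<close> times the probability of such instances.\<close>

section \<open>Binary losses\<close>

text \<open>At a label probability \<open>q\<close> equal to 0 or 1 this is the loss at a known
  label; in between it is a conditional expectation. One function, affine in \<open>q\<close>, thus
  covers both the surrogate and its conditional mean.\<close>

definition bin_risk :: "(int \<Rightarrow> real \<Rightarrow> real) \<Rightarrow> real \<Rightarrow> real \<Rightarrow> real" where
  "bin_risk \<phi> q u = q * \<phi> 1 u + (1 - q) * \<phi> (-1) u"

lemma link_inv:
  assumes "link_function \<gamma>"
  shows "link_inv \<gamma> u \<in> {0..1}" and "\<gamma> (link_inv \<gamma> u) = ereal u"
proof -
  have "inj_on \<gamma> {0..1}" and "ereal u \<in> \<gamma> ` {0..1}"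
    using assms by (auto simp: link_function_def)
  then show "link_inv \<gamma> u \<in> {0..1}" and "\<gamma> (link_inv \<gamma> u) = ereal u"
    unfolding link_inv_def by (rule the_inv_into_into[OF _ _ order_refl], rule f_the_inv_into_f)
qed

lemma link_neq:
  assumes "link_function \<gamma>" "p \<in> {0..1}" "a \<in> {0..1}" "p \<noteq> a" "\<gamma> p = ereal u" "\<gamma> a = ereal v"
  shows "u \<noteq> v"
  using assms inj_onD[of \<gamma> "{0..1}" p a] by (auto simp: link_function_def)

text \<open>At a finite value of the link \<open>loss_ext\<close> is the loss itself, so strict
  properness turns into a strict inequality between real risks.\<close>

lemma bin_risk_less:
  assumes "strictly_proper_composite \<phi> \<gamma>" "q \<in> {0..1}" "\<gamma> q = ereal v" "u \<noteq> v"
  shows "bin_risk \<phi> q v < bin_risk \<phi> q u"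
proof -
  have "\<forall>q\<in>{0..1}. \<forall>u::real. ereal u \<noteq> \<gamma> q \<longrightarrow>
      ereal q * (ereal (\<phi> 1 u) - loss_ext \<phi> 1 (\<gamma> q)) +
      ereal (1 - q) * (ereal (\<phi> (-1) u) - loss_ext \<phi> (-1) (\<gamma> q)) > 0"
    using assms(1) unfolding strictly_proper_composite_def by (elim conjE)
  from this[rule_format, OF assms(2), of u]
  have "ereal q * (ereal (\<phi> 1 u) - loss_ext \<phi> 1 (\<gamma> q)) +
      ereal (1 - q) * (ereal (\<phi> (-1) u) - loss_ext \<phi> (-1) (\<gamma> q)) > 0"
    using assms(3,4) by simp
  then show ?thesis
    unfolding assms(3) loss_ext_def bin_risk_def by (simp add: algebra_simps)
qed

text \<open>The sign change between \<open>p\<close> and \<open>y\<close> gives the slope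
  \<open>m\<close> the sign of \<open>y - p\<close>, and the last hypothesis says that
  \<open>q\<close> equals \<open>y\<close> or lies beyond it as seen from \<open>p\<close>.\<close>

lemma affine_beyond:
  fixes c m p y q :: real
  assumes "c + m * p < 0" "0 < c + m * y" "0 \<le> (q - y) * (y - p)"
  shows "c + m * y \<le> c + m * q"
proof (cases "p < y")
  case True
  have "0 < m * (y - p)" using assms by (simp add: algebra_simps)
  with True have "0 < m" by (simp add: zero_less_mult_iff)
  moreover have "q \<ge> y" using True assms(3) by (simp add: zero_le_mult_iff)
  ultimately show ?thesis by simp
next
  case False
  have "p \<noteq> y" using assms by auto
  with False have "y < p" by simp
  have "0 < m * (y - p)" using assms by (simp add: algebra_simps)
  with \<open>y < p\<close> have "m < 0" by (simp add: zero_less_mult_iff)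
  moreover have "q \<le> y" using \<open>y < p\<close> assms(3) by (simp add: zero_le_mult_iff)
  ultimately show ?thesis by simp
qed

lemma bin_risk_diff:
  "bin_risk \<phi> t u - bin_risk \<phi> t v =
     (\<phi> (-1) u - \<phi> (-1) v) + ((\<phi> 1 u - \<phi> 1 v) - (\<phi> (-1) u - \<phi> (-1) v)) * t"
  by (simp add: bin_risk_def algebra_simps)

text \<open>As a function of the label probability, the difference of two risks is affine and changes
  sign between the two predictions, so the risk grows as the prediction moves away from \<open>q\<close>.\<close>

lemma bin_risk_beyond:
  assumes spc: "strictly_proper_composite \<phi> \<gamma>"
    and "p \<in> {0..1}" "a \<in> {0..1}" "\<gamma> p = ereal u" "\<gamma> a = ereal v" "p \<noteq> a"
    and "0 \<le> (q - a) * (a - p)"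
  shows "bin_risk \<phi> a u - bin_risk \<phi> a v \<le> bin_risk \<phi> q u - bin_risk \<phi> q v"
proof -
  have "link_function \<gamma>" using spc by (simp add: strictly_proper_composite_def)
  then have "u \<noteq> v" using assms(2-6) by (auto dest: link_neq[of \<gamma> p a u v])
  have "bin_risk \<phi> p u - bin_risk \<phi> p v < 0" "0 < bin_risk \<phi> a u - bin_risk \<phi> a v"
    using bin_risk_less[OF spc, of p u v] bin_risk_less[OF spc, of a v u] assms(2-6) \<open>u \<noteq> v\<close> by auto
  then show ?thesis
    unfolding bin_risk_diff using assms(7) by (rule affine_beyond)
qed

text \<open>Multiples of \<open>1 / n\<close> with \<open>2 / n < \<epsilon>\<close> leave room for
  two consecutive ones. Two are provided because the drop in risk between a pair of grid points can
  be bounded below independently of \<open>p\<close> and \<open>q\<close>.\<close>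

lemma finite_grid:
  fixes \<epsilon> :: real
  assumes "\<epsilon> > 0"
  obtains G where "finite G" "G \<subseteq> {0<..<1}"
    "\<And>p q. 0 \<le> p \<Longrightarrow> p + \<epsilon> \<le> q \<Longrightarrow> q \<le> 1 \<Longrightarrow> \<exists>a\<in>G. \<exists>b\<in>G. p < a \<and> a < b \<and> b < q"
proof -
  obtain n :: nat where n: "2 / \<epsilon> < real n" using reals_Archimedean2 by blast
  have n0: "real n > 0" using n divide_pos_pos[OF zero_less_numeral assms] by (rule less_trans[rotated])
  have n2: "2 / real n < \<epsilon>" using n n0 assms by (simp add: field_simps)
  define G where "G = (\<lambda>k. real k / real n) ` {k. 0 < k \<and> k < n}"
  show ?thesis
  proof
    show "finite G" by (auto simp: G_def)
    show "G \<subseteq> {0<..<1}" using n0 by (auto simp: G_def)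
    fix p q :: real
    assume pq: "0 \<le> p" "p + \<epsilon> \<le> q" "q \<le> 1"
    \<comment> \<open>Floor plus one rather than ceiling: \<open>k / n\<close> exceeds
      \<open>p\<close> strictly even if \<open>p * n\<close> is an integer, and \<open>k\<close> is
      positive when \<open>p = 0\<close>.\<close>
    define k where "k = nat \<lfloor>p * n\<rfloor> + 1"
    have "real (nat \<lfloor>p * n\<rfloor>) = of_int \<lfloor>p * n\<rfloor>" using pq n0 by simp
    then have k: "p * n < real k" "real k \<le> p * n + 1" unfolding k_def by linarith+
    have "p < real k / n" "real k / n < real (Suc k) / n"
      using k n0 by (auto simp: field_simps)
    moreover have "real (Suc k) / n \<le> (p * n + 2) / n"
      using k n0 by (intro divide_right_mono) auto
    then have "real (Suc k) / n \<le> p + 2 / n" using n0 by (simp add: add_divide_distrib)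
    then have s: "real (Suc k) / n < q" using n2 pq by linarith
    then have "real (Suc k) / n < 1" using pq by linarith
    then have "Suc k < n" using n0 by (simp add: field_simps)
    moreover have "0 < k" by (simp add: k_def)
    ultimately show "\<exists>a\<in>G. \<exists>b\<in>G. p < a \<and> a < b \<and> b < q"
      using s unfolding G_def by (intro bexI[of _ "real k / n"] bexI[of _ "real (Suc k) / n"] conjI imageI) auto
  qed
qed

text \<open>Comparing with predictions from a finite grid in the open interval makes the gap uniform
  in \<open>q\<close> and avoids infinite values of the link.\<close>

lemma uniform_gap:
  fixes \<epsilon> :: real
  assumes spc: "strictly_proper_composite \<phi> \<gamma>" and "\<epsilon> > 0"
  obtains V \<delta> where "finite V" "\<delta> > 0"
    "\<And>q u. q \<in> {0..1} \<Longrightarrow> \<epsilon> \<le> \<bar>link_inv \<gamma> u - q\<bar> \<Longrightarrow>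
        \<exists>v\<in>V. bin_risk \<phi> q v + \<delta> \<le> bin_risk \<phi> q u"
proof -
  have link: "link_function \<gamma>" using spc by (simp add: strictly_proper_composite_def)
  obtain G where G: "finite G" "G \<subseteq> {0<..<1}"
    "\<And>p q. 0 \<le> p \<Longrightarrow> p + \<epsilon> \<le> q \<Longrightarrow> q \<le> 1 \<Longrightarrow> \<exists>a\<in>G. \<exists>b\<in>G. p < a \<and> a < b \<and> b < q"
    by (fact finite_grid[OF \<open>\<epsilon> > 0\<close>])
  define g where "g a = real_of_ereal (\<gamma> a)" for a
  have g: "\<gamma> a = ereal (g a)" if "a \<in> G" for a
  proof -
    have "a \<in> {0<..<1}" using that G(2) by blast
    then have "\<bar>\<gamma> a\<bar> \<noteq> \<infinity>" using link by (simp add: link_function_def)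
    then show ?thesis unfolding g_def by (simp add: ereal_real)
  qed
  \<comment> \<open>Excess risk, at label probability \<open>b\<close>, of the prediction
    \<open>g a\<close> over the optimal \<open>g b\<close>.\<close>
  define gap where "gap = (\<lambda>(a, b). bin_risk \<phi> b (g a) - bin_risk \<phi> b (g b))"
  define A where "A = {(a, b) \<in> G \<times> G. a \<noteq> b}"
  \<comment> \<open>The inserted 1 keeps the minimum defined when \<open>A\<close> is empty.\<close>
  define \<delta> where "\<delta> = Min (insert 1 (gap ` A))"
  have "finite A" unfolding A_def using G(1) by (auto intro: finite_subset[of _ "G \<times> G"])
  have gap_pos: "gap x > 0" if x: "x \<in> A" for x
  proof -
    obtain a b where ab: "x = (a, b)" "a \<in> G" "b \<in> G" "a \<noteq> b" using x by (auto simp: A_def)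
    have "a \<in> {0..1}" "b \<in> {0..1}" using ab G(2) by force+
    then have "g a \<noteq> g b"
      using link_neq[OF link, of a b "g a" "g b"] ab g by auto
    then show ?thesis
      using bin_risk_less[OF spc \<open>b \<in> {0..1}\<close> g[OF ab(3)]] ab by (simp add: gap_def)
  qed
  show ?thesis
  proof
    show "finite (g ` G)" using G(1) by simp
    show "\<delta> > 0" unfolding \<delta>_def using gap_pos \<open>finite A\<close> by (subst Min_gr_iff) auto
    fix q u
    assume q: "q \<in> {0..1}" and far: "\<epsilon> \<le> \<bar>link_inv \<gamma> u - q\<bar>"
    define p where "p = link_inv \<gamma> u"
    have p: "p \<in> {0..1}" "\<gamma> p = ereal u" unfolding p_def using link_inv[OF link] by auto
    have "\<exists>a\<in>G. \<exists>b\<in>G. (p < a \<and> a < b \<and> b < q) \<or> (q < b \<and> b < a \<and> a < p)"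
    proof (cases "p < q")
      case True
      then show ?thesis using G(3)[of p q] far p q unfolding p_def[symmetric] by force
    next
      case False
      then show ?thesis using G(3)[of q p] far p q unfolding p_def[symmetric] by force
    qed
    then obtain a b where ab: "a \<in> G" "b \<in> G"
      and ord: "(p < a \<and> a < b \<and> b < q) \<or> (q < b \<and> b < a \<and> a < p)" by blast
    have ab01: "a \<in> {0..1}" "b \<in> {0..1}" using ab G(2) by force+
    \<comment> \<open>First leg, from \<open>u\<close> to \<open>g a\<close>: the size of this drop
      depends on \<open>u\<close>, so only its sign is used.\<close>
    have "0 < bin_risk \<phi> a u - bin_risk \<phi> a (g a)"
    proof -
      have "u \<noteq> g a" using link_neq[OF link p(1) ab01(1) _ p(2) g[OF ab(1)]] ord by auto
      then show ?thesis using bin_risk_less[OF spc ab01(1) g[OF ab(1)]] by simp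
    qed
    also have "\<dots> \<le> bin_risk \<phi> q u - bin_risk \<phi> q (g a)"
      using ord by (intro bin_risk_beyond[OF spc p(1) ab01(1) p(2) g[OF ab(1)]])
        (auto simp: zero_le_mult_iff)
    finally have 1: "bin_risk \<phi> q (g a) \<le> bin_risk \<phi> q u" by simp
    \<comment> \<open>Second leg, from \<open>g a\<close> to \<open>g b\<close>: both ends lie on
      the grid, and the drop at \<open>q\<close> is at least the drop at \<open>b\<close>, hence at
      least \<open>\<delta>\<close>.\<close>
    have "(a, b) \<in> A" using ab ord by (auto simp: A_def)
    then have "\<delta> \<le> gap (a, b)" unfolding \<delta>_def using \<open>finite A\<close> by (intro Min_le) auto
    also have "\<dots> \<le> bin_risk \<phi> q (g a) - bin_risk \<phi> q (g b)"
      unfolding gap_def prod.case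
      using ord by (intro bin_risk_beyond[OF spc ab01 g[OF ab(1)] g[OF ab(2)]])
        (auto simp: zero_le_mult_iff)
    finally show "\<exists>v\<in>g ` G. bin_risk \<phi> q v + \<delta> \<le> bin_risk \<phi> q u" using 1 ab by force
  qed
qed

section \<open>Measurable improvement of a prediction\<close>

lemma measurable_bin_risk:
  assumes "binary_loss \<phi>" and [measurable]: "q \<in> borel_measurable M" "u \<in> borel_measurable M"
  shows "(\<lambda>x. bin_risk \<phi> (q x) (u x)) \<in> borel_measurable M"
proof -
  have [measurable]: "\<phi> 1 \<in> borel_measurable borel" "\<phi> (-1) \<in> borel_measurable borel"
    using assms(1) by (auto simp: binary_loss_def)
  show ?thesis unfolding bin_risk_def by measurable
qed

lemma bin_risk_nonneg: "binary_loss \<phi> \<Longrightarrow> q \<in> {0..1} \<Longrightarrow> 0 \<le> bin_risk \<phi> q u"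
  by (auto simp: bin_risk_def binary_loss_def)

text \<open>The values of \<open>V\<close> are inserted one at a time, each replacing the current
  prediction on the measurable set where it has smaller risk. This supplies the competitors for the
  infimum in the surrogate regret.\<close>

lemma measurable_improvement:
  assumes "binary_loss \<phi>" "finite V"
    and [measurable]: "q \<in> borel_measurable M" "u \<in> borel_measurable M"
  obtains g where "g \<in> borel_measurable M"
    "\<And>x. bin_risk \<phi> (q x) (g x) \<le> bin_risk \<phi> (q x) (u x)"
    "\<And>x v. v \<in> V \<Longrightarrow> bin_risk \<phi> (q x) (g x) \<le> bin_risk \<phi> (q x) v"
proof -
  note [measurable] = measurable_bin_risk[OF assms(1)]
  have "\<exists>g\<in>borel_measurable M. (\<forall>x. bin_risk \<phi> (q x) (g x) \<le> bin_risk \<phi> (q x) (u x)) \<and>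
      (\<forall>x. \<forall>v\<in>V. bin_risk \<phi> (q x) (g x) \<le> bin_risk \<phi> (q x) v)"
    using assms(2)
  proof induction
    case empty
    show ?case using assms(4) by auto
  next
    case (insert v V)
    then obtain g where [measurable]: "g \<in> borel_measurable M"
      and g: "\<And>x. bin_risk \<phi> (q x) (g x) \<le> bin_risk \<phi> (q x) (u x)"
        "\<And>x v. v \<in> V \<Longrightarrow> bin_risk \<phi> (q x) (g x) \<le> bin_risk \<phi> (q x) v"
      by blast
    define h where "h x = (if bin_risk \<phi> (q x) v < bin_risk \<phi> (q x) (g x) then v else g x)" for x
    have "h \<in> borel_measurable M" unfolding h_def by measurable
    moreover have h: "bin_risk \<phi> (q x) (h x) \<le> bin_risk \<phi> (q x) (g x)"
      "bin_risk \<phi> (q x) (h x) \<le> bin_risk \<phi> (q x) v" for x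
      by (auto simp: h_def)
    ultimately show ?case
      using order_trans[OF h(1) g(1)] order_trans[OF h(1) g(2)]
      by (intro bexI[of _ h]) simp_all
  qed
  then obtain g where "g \<in> borel_measurable M"
    "\<forall>x. bin_risk \<phi> (q x) (g x) \<le> bin_risk \<phi> (q x) (u x)"
    "\<forall>x. \<forall>v\<in>V. bin_risk \<phi> (q x) (g x) \<le> bin_risk \<phi> (q x) v" by (elim bexE conjE)
  then show ?thesis by (intro that[of g]) simp_all
qed

section \<open>Conditional label probabilities\<close>

lemma measurable_prod_count_space:
  assumes "finite Y" "\<And>y. y \<in> Y \<Longrightarrow> (\<lambda>x. g x y) \<in> X \<rightarrow>\<^sub>M N"
  shows "(\<lambda>(x, y). g x y) \<in> X \<Otimes>\<^sub>M count_space Y \<rightarrow>\<^sub>M N"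
proof -
  have "(\<lambda>z. (\<lambda>y z. g (fst z) y) (snd z) z) \<in> X \<Otimes>\<^sub>M count_space Y \<rightarrow>\<^sub>M N"
  proof (rule measurable_compose_countable'[where I = Y])
    show "(\<lambda>z. g (fst z) y) \<in> X \<Otimes>\<^sub>M count_space Y \<rightarrow>\<^sub>M N" if "y \<in> Y" for y
      using assms(2)[OF that] by (rule measurable_compose[OF measurable_fst])
    show "countable Y" using assms(1) by (rule countable_finite)
  qed (rule measurable_snd)
  then show ?thesis by (simp add: case_prod_beta')
qed

text \<open>Since \<open>Y\<close> is finite, one Radon-Nikodym derivative per label with respect to
  the instance marginal \<open>\<mu>\<close> yields the conditional distribution over an arbitrary
  instance space.\<close>

lemma conditional_probabilities:
  assumes "prob_space D" and D: "sets D = sets (X \<Otimes>\<^sub>M count_space Y)" and Y: "finite Y"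
  obtains \<mu> \<eta> where "prob_space \<mu>" "sets \<mu> = sets X"
    "\<And>y. (\<eta> y :: 'x \<Rightarrow> real) \<in> borel_measurable X"
    "\<And>x y. 0 \<le> \<eta> y x" "\<And>x. (\<Sum>y\<in>Y. \<eta> y x) = 1"
    "\<And>g. (\<And>y. y \<in> Y \<Longrightarrow> g y \<in> borel_measurable X) \<Longrightarrow>
       (\<integral>\<^sup>+(x, y). ennreal (g y x) \<partial>D) = (\<integral>\<^sup>+x. (\<Sum>y\<in>Y. ennreal (\<eta> y x) * ennreal (g y x)) \<partial>\<mu>)"
proof -
  interpret prob_space D by fact
  have D' [measurable_cong]: "sets D = sets (X \<Otimes>\<^sub>M count_space Y)" by fact
  have fst_m [measurable]: "fst \<in> D \<rightarrow>\<^sub>M X" and snd_m [measurable]: "snd \<in> D \<rightarrow>\<^sub>M count_space Y"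
    by measurable
  have spD: "space D = space X \<times> Y"
    using sets_eq_imp_space_eq[OF D] by (simp add: space_pair_measure)
  then obtain y0 where y0: "y0 \<in> Y" using not_empty by auto
  define \<mu> where "\<mu> = distr D X fst"
  interpret \<mu>: prob_space \<mu> unfolding \<mu>_def by (rule prob_space_distr) measurable
  have sets_\<mu> [measurable_cong]: "sets \<mu> = sets X" by (simp add: \<mu>_def)
  have ind_m: "(\<lambda>z. indicator {y} (snd z)) \<in> borel_measurable D" for y
    by (rule measurable_compose[OF snd_m]) auto
  \<comment> \<open>The part of \<open>D\<close> with label \<open>y\<close>, projected to the
    instances.\<close>
  define \<nu> where "\<nu> y = distr (density D (\<lambda>z. indicator {y} (snd z))) X fst" for y
  have \<nu>_int: "(\<integral>\<^sup>+x. h x \<partial>\<nu> y) = (\<integral>\<^sup>+z. indicator {y} (snd z) * h (fst z) \<partial>D)"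
    if "h \<in> borel_measurable X" for h y
  proof -
    have "(\<integral>\<^sup>+x. h x \<partial>\<nu> y) = (\<integral>\<^sup>+z. h (fst z) \<partial>density D (\<lambda>z. indicator {y} (snd z)))"
      unfolding \<nu>_def using that by (intro nn_integral_distr) measurable
    also have "\<dots> = (\<integral>\<^sup>+z. indicator {y} (snd z) * h (fst z) \<partial>D)"
      using that ind_m by (intro nn_integral_density) (auto intro: measurable_compose[OF fst_m])
    finally show ?thesis .
  qed
  have "\<exists>h\<in>borel_measurable \<mu>. density \<mu> h = \<nu> y" for y
  proof (rule \<mu>.Radon_Nikodym)
    \<comment> \<open>Dropping the constraint on the label only increases the mass, so
      \<open>\<nu> y\<close> is dominated by \<open>\<mu>\<close>.\<close>
    show "absolutely_continuous \<mu> (\<nu> y)"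
      unfolding absolutely_continuous_def
    proof
      fix A assume A: "A \<in> null_sets \<mu>"
      then have "A \<in> sets X" by (auto simp: sets_\<mu>)
      have "emeasure (\<nu> y) A = (\<integral>\<^sup>+x. indicator A x \<partial>\<nu> y)"
        using \<open>A \<in> sets X\<close> by (simp add: \<nu>_def)
      also have "\<dots> \<le> (\<integral>\<^sup>+z. indicator A (fst z) \<partial>D)"
        using \<open>A \<in> sets X\<close> 
        by (subst \<nu>_int) (auto intro!: nn_integral_mono simp: indicator_def)
      also have "\<dots> = (\<integral>\<^sup>+x. indicator A x \<partial>\<mu>)"
        unfolding \<mu>_def using \<open>A \<in> sets X\<close> by (intro nn_integral_distr[symmetric]) auto
      also have "\<dots> = 0" using A \<open>A \<in> sets X\<close> by (auto simp: sets_\<mu>)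
      finally show "A \<in> null_sets (\<nu> y)" using \<open>A \<in> sets X\<close> by (auto simp: \<nu>_def)
    qed
    show "sets (\<nu> y) = sets \<mu>" by (simp add: \<nu>_def sets_\<mu>)
  qed
  then obtain h where h [measurable]: "\<And>y. h y \<in> borel_measurable \<mu>"
    and dens: "\<And>y. density \<mu> (h y) = \<nu> y" by metis
  have h_X [measurable]: "\<And>y. h y \<in> borel_measurable X"
    using h measurable_cong_sets[OF sets_\<mu> refl] by blast
  have disint: "(\<integral>\<^sup>+(x, y). g y x \<partial>D) = (\<integral>\<^sup>+x. (\<Sum>y\<in>Y. h y x * g y x) \<partial>\<mu>)"
    if g: "\<And>y. y \<in> Y \<Longrightarrow> g y \<in> borel_measurable X" for g
  proof -
    have g\<mu>: "\<And>y. y \<in> Y \<Longrightarrow> g y \<in> borel_measurable \<mu>"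
      using g measurable_cong_sets[OF sets_\<mu> refl] by blast
    have "(\<integral>\<^sup>+(x, y). g y x \<partial>D) = (\<integral>\<^sup>+z. (\<Sum>y\<in>Y. indicator {y} (snd z) * g y (fst z)) \<partial>D)"
    proof (intro nn_integral_cong)
      fix z assume z: "z \<in> space D"
      then have "snd z \<in> Y" by (auto simp: spD)
      then show "(case z of (x, y) \<Rightarrow> g y x) = (\<Sum>y\<in>Y. indicator {y} (snd z) * g y (fst z))"
        using Y by (subst sum.remove[of _ "snd z"])
          (auto simp: case_prod_beta indicator_def intro!: sum.neutral)
    qed
    also have "\<dots> = (\<Sum>y\<in>Y. \<integral>\<^sup>+z. indicator {y} (snd z) * g y (fst z) \<partial>D)"
      by (intro nn_integral_sum borel_measurable_times_ennreal ind_m measurable_compose[OF fst_m] g)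
    also have "\<dots> = (\<Sum>y\<in>Y. \<integral>\<^sup>+x. g y x \<partial>\<nu> y)"
      by (intro sum.cong refl \<nu>_int[symmetric] g)
    also have "\<dots> = (\<Sum>y\<in>Y. \<integral>\<^sup>+x. h y x * g y x \<partial>\<mu>)"
      unfolding dens[symmetric] by (intro sum.cong refl nn_integral_density h g\<mu>)
    also have "\<dots> = (\<integral>\<^sup>+x. (\<Sum>y\<in>Y. h y x * g y x) \<partial>\<mu>)"
      by (intro nn_integral_sum[symmetric] borel_measurable_times_ennreal h g\<mu>)
    finally show ?thesis .
  qed
  \<comment> \<open>The measures \<open>\<nu> y\<close> add up to \<open>\<mu>\<close>, so by
    uniqueness of densities the \<open>h y\<close> sum to 1 almost everywhere.\<close>
  have "density \<mu> (\<lambda>x. \<Sum>y\<in>Y. h y x) = density \<mu> (\<lambda>_. 1)"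
  proof (rule measure_eqI)
    fix A assume "A \<in> sets (density \<mu> (\<lambda>x. \<Sum>y\<in>Y. h y x))"
    then have A: "A \<in> sets \<mu>" "A \<in> sets X" by (auto simp: sets_\<mu>)
    have "emeasure (density \<mu> (\<lambda>x. \<Sum>y\<in>Y. h y x)) A = (\<integral>\<^sup>+x. (\<Sum>y\<in>Y. h y x) * indicator A x \<partial>\<mu>)"
      using A by (intro emeasure_density) auto
    also have "\<dots> = (\<integral>\<^sup>+(x, y). indicator A x \<partial>D)"
      using A by (subst disint) (auto simp: sum_distrib_right)
    also have "\<dots> = (\<integral>\<^sup>+x. indicator A x \<partial>\<mu>)"
      unfolding \<mu>_def using A by (subst nn_integral_distr) (auto simp: case_prod_beta')
    finally show "emeasure (density \<mu> (\<lambda>x. \<Sum>y\<in>Y. h y x)) A = emeasure (density \<mu> (\<lambda>_. 1)) A"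
      using A by (simp add: emeasure_density)
  qed simp
  then have ae: "AE x in \<mu>. (\<Sum>y\<in>Y. h y x) = 1"
    by (subst (asm) \<mu>.density_unique_iff) auto
  \<comment> \<open>On the exceptional null set all mass goes to the fixed label \<open>y0\<close>,
    so the probabilities sum to 1 at every point and not just almost everywhere.\<close>
  define \<eta> where "\<eta> y x = (if (\<Sum>y\<in>Y. h y x) = 1 then enn2real (h y x) else of_bool (y = y0))" for y x
  have fin: "h y x < \<top>" if "(\<Sum>y\<in>Y. h y x) = 1" "y \<in> Y" for x y
    using that Y 
    by (intro le_less_trans[OF member_le_sum[of y Y "\<lambda>y. h y x"]]) auto
  show ?thesis
  proof
    show "prob_space \<mu>" by unfold_locales
    show "sets \<mu> = sets X" by fact
    show "\<eta> y \<in> borel_measurable X" for y unfolding \<eta>_def by measurable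
    show "0 \<le> \<eta> y x" for y x by (auto simp: \<eta>_def)
    show "(\<Sum>y\<in>Y. \<eta> y x) = 1" for x
    proof (cases "(\<Sum>y\<in>Y. h y x) = 1")
      case True
      have "(\<Sum>y\<in>Y. enn2real (h y x)) = enn2real (\<Sum>y\<in>Y. h y x)"
        using fin[OF True] by (subst enn2real_sum) (auto simp: comp_def)
      then show ?thesis using True by (simp add: \<eta>_def)
    next
      case False
      then show ?thesis using Y y0 by (simp add: \<eta>_def of_bool_def if_distrib)
    qed
    fix g :: "_ \<Rightarrow> 'x \<Rightarrow> real"
    assume g [measurable]: "\<And>y. y \<in> Y \<Longrightarrow> g y \<in> borel_measurable X"
    have "(\<integral>\<^sup>+(x, y). ennreal (g y x) \<partial>D) = (\<integral>\<^sup>+x. (\<Sum>y\<in>Y. h y x * ennreal (g y x)) \<partial>\<mu>)"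
      by (intro disint) measurable
    also have "\<dots> = (\<integral>\<^sup>+x. (\<Sum>y\<in>Y. ennreal (\<eta> y x) * ennreal (g y x)) \<partial>\<mu>)"
    proof (intro nn_integral_cong_AE, use ae in eventually_elim)
      case (elim x)
      then show ?case using fin[OF elim] by (intro sum.cong) (auto simp: \<eta>_def)
    qed
    finally show "(\<integral>\<^sup>+(x, y). ennreal (g y x) \<partial>D) = \<dots>" .
  qed
qed

section \<open>The surrogate and the F-beta loss in coordinates\<close>

text \<open>\<open>None\<close> stands for the index \<open>0\<close> of a score vector.\<close>

definition coords :: "nat \<Rightarrow> (nat \<times> nat) option set" where
  "coords s = insert None (Some ` ({1..s} \<times> {1..s}))"

definition coord :: "score \<Rightarrow> (nat \<times> nat) option \<Rightarrow> real" where
  "coord u i = (case i of None \<Rightarrow> fst u | Some jk \<Rightarrow> snd u jk)"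

definition coef_a :: "nat \<Rightarrow> (nat \<Rightarrow> nat) \<Rightarrow> (nat \<times> nat) option \<Rightarrow> real" where
  "coef_a s y i = (case i of None \<Rightarrow> coeff_a0 s y | Some (j, k) \<Rightarrow> coeff_a s y j k)"

definition coef_b :: "nat \<Rightarrow> real \<Rightarrow> (nat \<Rightarrow> nat) \<Rightarrow> (nat \<times> nat) option \<Rightarrow> real" where
  "coef_b s \<beta> z i = (case i of None \<Rightarrow> coeff_b0 s z | Some (j, k) \<Rightarrow> coeff_b s \<beta> z j k)"

lemma finite_coords [simp]: "finite (coords s)"
  by (simp add: coords_def)

lemma coords_nonempty: "coords s \<noteq> {}"
  by (simp add: coords_def)

lemma sum_coords: "(\<Sum>i\<in>coords s. g i) = g None + (\<Sum>j=1..s. \<Sum>k=1..s. g (Some (j, k)))"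
proof -
  have "(\<Sum>i\<in>coords s. g i) = g None + (\<Sum>i\<in>Some ` ({1..s} \<times> {1..s}). g i)"
    unfolding coords_def by (subst sum.insert) auto
  also have "(\<Sum>i\<in>Some ` ({1..s} \<times> {1..s}). g i) = (\<Sum>jk\<in>{1..s} \<times> {1..s}. g (Some jk))"
    by (subst sum.reindex) auto
  also have "\<dots> = (\<Sum>j=1..s. \<Sum>k=1..s. g (Some (j, k)))"
    by (simp add: sum.cartesian_product case_prod_beta)
  finally show ?thesis .
qed

lemma surrogate_coords:
  "surrogate s \<phi> y u = (\<Sum>i\<in>coords s. bin_risk \<phi> (coef_a s y i) (coord u i))"
  by (simp add: sum_coords surrogate_def bin_risk_def coef_a_def coord_def)

lemma decode_objective_coords:
  "decode_objective s \<beta> \<gamma> u z = (\<Sum>i\<in>coords s. coef_b s \<beta> z i * link_inv \<gamma> (coord u i))"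
  by (simp add: sum_coords decode_objective_def coef_b_def coord_def)

section \<open>The F-beta loss as a bilinear form, and its bounds\<close>

lemma finite_labels [simp]: "finite (labels s)"
  unfolding labels_def by (intro finite_PiE) auto

lemma labels_01: "y \<in> labels s \<Longrightarrow> j \<in> {1..s} \<Longrightarrow> y j = 0 \<or> y j = 1"
  by (auto simp: labels_def PiE_iff)

lemma norm1_le: "y \<in> labels s \<Longrightarrow> norm1 s y \<le> s"
  unfolding norm1_def using sum_bounded_above[of "{1..s}" y 1] labels_01[of y s] by force

lemma coef_a_01: "y \<in> labels s \<Longrightarrow> i \<in> coords s \<Longrightarrow> coef_a s y i \<in> {0..1}"
  by (auto simp: coords_def coef_a_def coeff_a0_def coeff_a_def dest: labels_01)

text \<open>Once \<open>k\<close> is fixed as the norm of \<open>y\<close>, the denominator depends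
  on \<open>z\<close> alone and the F-measure is linear in \<open>y\<close>; the indicators in
  \<open>coef_a\<close> select this \<open>k\<close>. Index \<open>None\<close> supplies the value 1
  for two zero vectors.\<close>

lemma F_loss_coords:
  assumes "\<beta> > 0" "y \<in> labels s"
  shows "F_loss s \<beta> y z = 1 + (\<Sum>i\<in>coords s. coef_a s y i * coef_b s \<beta> z i)"
proof (cases "norm1 s y = 0")
  case True
  then have y0: "y j = 0" if "j \<in> {1..s}" for j using that by (simp add: norm1_def)
  have "(\<Sum>j=1..s. \<Sum>k=1..s. coeff_a s y j k * coeff_b s \<beta> z j k) = 0"
    using y0 by (intro sum.neutral ballI) (auto simp: coeff_a_def)
  moreover have "(\<Sum>j=1..s. real (y j) * real (z j)) = 0"
    using y0 by (intro sum.neutral ballI) auto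
  ultimately show ?thesis using True
    by (simp add: F_loss_def F_measure_def sum_coords coef_a_def coef_b_def coeff_a0_def coeff_b0_def)
next
  case False
  define n where "n = norm1 s y"
  have n: "n \<in> {1..s}" using False norm1_le[OF assms(2)] by (auto simp: n_def)
  have d: "\<beta>\<^sup>2 * real n + real (norm1 s z) > 0"
    using n assms(1) by (intro add_pos_nonneg) auto
  \<comment> \<open>The indicator leaves only \<open>k = n\<close>, a term that occurs because
    \<open>n\<close> lies in \<open>{1..s}\<close>.\<close>
  have "(\<Sum>k=1..s. coeff_a s y j k * coeff_b s \<beta> z j k) = real (y j) * coeff_b s \<beta> z j n" for j
  proof -
    have "(\<Sum>k=1..s. coeff_a s y j k * coeff_b s \<beta> z j k) =
        (\<Sum>k=1..s. if n = k then real (y j) * coeff_b s \<beta> z j k else 0)"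
      by (intro sum.cong) (auto simp: coeff_a_def n_def)
    then show ?thesis using n by simp
  qed
  then have "(\<Sum>i\<in>coords s. coef_a s y i * coef_b s \<beta> z i) = (\<Sum>j=1..s. real (y j) * coeff_b s \<beta> z j n)"
    using False by (simp add: sum_coords coef_a_def coef_b_def coeff_a0_def)
  also have "\<dots> = - ((1 + \<beta>\<^sup>2) * (\<Sum>j=1..s. real (y j) * real (z j)) /
      (\<beta>\<^sup>2 * real n + real (norm1 s z)))"
    by (simp add: coeff_b_def sum_distrib_left sum_divide_distrib sum_negf mult_ac)
  finally show ?thesis
    using d by (simp add: F_loss_def F_measure_def n_def[symmetric])
qed

text \<open>The overlap \<open>?S\<close> is at most each of the two norms; these bounds, weighted
  by \<open>\<beta>\<^sup>2\<close> and 1, add up to numerator at most denominator.\<close>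

lemma F_loss_01:
  assumes "y \<in> labels s" "z \<in> labels s"
  shows "F_loss s \<beta> y z \<in> {0..1}"
proof -
  let ?S = "\<Sum>j=1..s. real (y j) * real (z j)"
  have "?S \<le> real (norm1 s y)" "?S \<le> real (norm1 s z)"
    unfolding norm1_def of_nat_sum
    using labels_01[OF assms(1)] labels_01[OF assms(2)] by (intro sum_mono; force)+
  then have "(1 + \<beta>\<^sup>2) * ?S \<le> \<beta>\<^sup>2 * real (norm1 s y) + real (norm1 s z)"
    by (simp add: distrib_right add.commute add_mono mult_left_mono)
  moreover have "0 \<le> ?S" by (intro sum_nonneg) simp
  moreover have "0 \<le> \<beta>\<^sup>2 * real (norm1 s y) + real (norm1 s z)" by simp
  ultimately show ?thesis
    by (auto simp: F_loss_def F_measure_def Let_def divide_le_eq_1 less_le intro!: divide_nonneg_nonneg)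
qed

text \<open>As \<open>k\<close> is at least 1, the denominator is at least
  \<open>\<beta>\<^sup>2\<close> even for the zero prediction; the coefficient at
  \<open>None\<close> is 0 or -1.\<close>

lemma coef_b_bound:
  assumes "\<beta> > 0" "z \<in> labels s" "i \<in> coords s"
  shows "\<bar>coef_b s \<beta> z i\<bar> \<le> (1 + \<beta>\<^sup>2) / \<beta>\<^sup>2"
proof (cases i)
  case None
  have "\<beta>\<^sup>2 / \<beta>\<^sup>2 \<le> (1 + \<beta>\<^sup>2) / \<beta>\<^sup>2" by (intro divide_right_mono) auto
  then have "1 \<le> (1 + \<beta>\<^sup>2) / \<beta>\<^sup>2" using assms(1) by simp
  then show ?thesis unfolding None coef_b_def coeff_b0_def option.case by (cases "norm1 s z = 0") auto
next
  case (Some jk)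
  then obtain j k where jk: "i = Some (j, k)" "j \<in> {1..s}" "k \<in> {1..s}"
    using assms(3) by (auto simp: coords_def)
  have "\<beta>\<^sup>2 * 1 \<le> \<beta>\<^sup>2 * real k + real (norm1 s z)"
    using jk by (intro add_increasing2 mult_left_mono) auto
  moreover have "(1 + \<beta>\<^sup>2) * real (z j) \<le> (1 + \<beta>\<^sup>2) * 1"
    using labels_01[OF assms(2) jk(2)] by (intro mult_left_mono) auto
  ultimately have "(1 + \<beta>\<^sup>2) * real (z j) / (\<beta>\<^sup>2 * real k + real (norm1 s z)) \<le> (1 + \<beta>\<^sup>2) / \<beta>\<^sup>2"
    using assms(1) by (intro frac_le) auto
  moreover have "0 \<le> (1 + \<beta>\<^sup>2) * real (z j) / (\<beta>\<^sup>2 * real k + real (norm1 s z))" by simp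
  ultimately show ?thesis
    unfolding jk coef_b_def coeff_b_def option.case prod.case abs_minus_cancel by (simp only: abs_of_nonneg)
qed

section \<open>Measurability of scores and of the surrogate\<close>

lemma measurable_coord:
  assumes "i \<in> coords s"
  shows "(\<lambda>u. coord u i) \<in> borel_measurable (scores s)"
proof (cases i)
  case None
  then show ?thesis unfolding coord_def scores_def by simp
next
  case (Some jk)
  then have "jk \<in> {1..s} \<times> {1..s}" using assms by (auto simp: coords_def)
  then have "(\<lambda>u. snd u jk) \<in> borel_measurable (scores s)"
    unfolding scores_def
    by (rule measurable_compose[OF measurable_snd measurable_component_singleton])
  then show ?thesis by (simp add: Some coord_def)
qed

lemma measurable_score:
  assumes "\<And>i. i \<in> coords s \<Longrightarrow> g i \<in> borel_measurable M"
  shows "(\<lambda>x. (g None x, \<lambda>jk\<in>{1..s} \<times> {1..s}. g (Some jk) x)) \<in> M \<rightarrow>\<^sub>M scores s"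
  unfolding scores_def using assms
  by (intro measurable_Pair measurable_restrict) (auto simp: coords_def)

lemma measurable_surrogate:
  assumes "binary_loss \<phi>"
  shows "surrogate s \<phi> y \<in> borel_measurable (scores s)"
  unfolding surrogate_coords
  by (intro borel_measurable_sum measurable_bin_risk[OF assms] measurable_coord) auto

lemma surrogate_nonneg:
  "binary_loss \<phi> \<Longrightarrow> y \<in> labels s \<Longrightarrow> 0 \<le> surrogate s \<phi> y u"
  unfolding surrogate_coords by (intro sum_nonneg bin_risk_nonneg coef_a_01)

section \<open>Comparison of the regrets\<close>

text \<open>One fixed distribution in disintegrated form, with instance marginal
  \<open>\<mu>\<close> and conditional label probabilities \<open>\<eta>\<close>. The regret
  comparison concerns single models; sampling enters only afterwards.\<close>

locale label_model = prob_space \<mu> for \<mu> :: "'x measure" +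
  fixes X :: "'x measure" and D :: "('x \<times> (nat \<Rightarrow> nat)) measure"
    and \<eta> :: "(nat \<Rightarrow> nat) \<Rightarrow> 'x \<Rightarrow> real"
    and s :: nat and \<beta> :: real and \<phi> :: "int \<Rightarrow> real \<Rightarrow> real" and \<gamma> :: "real \<Rightarrow> ereal"
    and dec :: "score \<Rightarrow> nat \<Rightarrow> nat"
  assumes sets_\<mu>: "sets \<mu> = sets X"
    and sets_D: "sets D = sets (X \<Otimes>\<^sub>M count_space (labels s))"
    and \<eta>_measurable: "\<And>y. \<eta> y \<in> borel_measurable X"
    and \<eta>_nonneg: "\<And>x y. 0 \<le> \<eta> y x"
    and \<eta>_sum: "\<And>x. (\<Sum>y\<in>labels s. \<eta> y x) = 1"
    and disintegration: "\<And>g. (\<And>y. y \<in> labels s \<Longrightarrow> g y \<in> borel_measurable X) \<Longrightarrow>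
       (\<integral>\<^sup>+(x, y). ennreal (g y x) \<partial>D) =
       (\<integral>\<^sup>+x. (\<Sum>y\<in>labels s. ennreal (\<eta> y x) * ennreal (g y x)) \<partial>\<mu>)"
    and \<beta>_pos: "\<beta> > 0"
    and spc: "strictly_proper_composite \<phi> \<gamma>"
    and dec: "is_decoding s \<beta> \<gamma> dec"
begin

lemma binary_loss: "binary_loss \<phi>" and link: "link_function \<gamma>"
  using spc by (simp_all add: strictly_proper_composite_def)

lemma space_\<mu>: "space \<mu> = space X"
  by (rule sets_eq_imp_space_eq[OF sets_\<mu>])

lemma measurable_\<mu>: "f \<in> borel_measurable X \<Longrightarrow> f \<in> borel_measurable \<mu>"
  using measurable_cong_sets[OF sets_\<mu> refl] by blast

text \<open>Given \<open>x\<close>, this is for \<open>None\<close> the probability of the zero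
  label vector, and for \<open>Some (j, k)\<close> that of a label vector with \<open>k\<close>
  ones, one of them in position \<open>j\<close>.\<close>

definition q :: "(nat \<times> nat) option \<Rightarrow> 'x \<Rightarrow> real" where
  "q i x = (\<Sum>y\<in>labels s. \<eta> y x * coef_a s y i)"

lemma measurable_q: "q i \<in> borel_measurable X"
  unfolding q_def using \<eta>_measurable by (intro borel_measurable_sum borel_measurable_times) auto

lemma q_01:
  assumes "i \<in> coords s"
  shows "q i x \<in> {0..1}"
proof -
  have "q i x \<le> (\<Sum>y\<in>labels s. \<eta> y x * 1)"
    unfolding q_def using coef_a_01[OF _ assms] \<eta>_nonneg
    by (intro sum_mono mult_left_mono) auto
  moreover have "0 \<le> q i x"
    unfolding q_def using coef_a_01[OF _ assms] \<eta>_nonneg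
    by (intro sum_nonneg mult_nonneg_nonneg) auto
  ultimately show ?thesis by (simp add: \<eta>_sum)
qed

definition cond_risk :: "score \<Rightarrow> 'x \<Rightarrow> real" where
  "cond_risk u x = (\<Sum>i\<in>coords s. bin_risk \<phi> (q i x) (coord u i))"

text \<open>\<open>bin_risk\<close> is affine in the label probability and the weights
  \<open>\<eta>\<close> sum to 1, so averaging over the labels passes into that argument.\<close>

lemma cond_risk_eq: "(\<Sum>y\<in>labels s. \<eta> y x * surrogate s \<phi> y u) = cond_risk u x"
proof -
  have "(\<Sum>y\<in>labels s. \<eta> y x * bin_risk \<phi> (coef_a s y i) v) = bin_risk \<phi> (q i x) v" for i v
  proof -
    have "(\<Sum>y\<in>labels s. \<eta> y x * bin_risk \<phi> (coef_a s y i) v) =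
        (\<Sum>y\<in>labels s. \<eta> y x * coef_a s y i * \<phi> 1 v +
           (\<eta> y x * \<phi> (-1) v - \<eta> y x * coef_a s y i * \<phi> (-1) v))"
      by (intro sum.cong) (auto simp: bin_risk_def algebra_simps)
    also have "\<dots> = q i x * \<phi> 1 v + ((\<Sum>y\<in>labels s. \<eta> y x) * \<phi> (-1) v - q i x * \<phi> (-1) v)"
      by (simp add: q_def sum.distrib sum_subtractf sum_distrib_right)
    finally show ?thesis by (simp add: bin_risk_def \<eta>_sum algebra_simps)
  qed
  then show ?thesis
    unfolding cond_risk_def surrogate_coords sum_distrib_left by (subst sum.swap) simp
qed

lemma surrogate_er_eq:
  assumes f: "f \<in> X \<rightarrow>\<^sub>M scores s"
  shows "surrogate_er D (surrogate s \<phi>) f = (\<integral>\<^sup>+x. ennreal (cond_risk (f x) x) \<partial>\<mu>)"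
proof -
  have "surrogate_er D (surrogate s \<phi>) f =
      (\<integral>\<^sup>+x. (\<Sum>y\<in>labels s. ennreal (\<eta> y x) * ennreal (surrogate s \<phi> y (f x))) \<partial>\<mu>)"
    unfolding surrogate_er_def
    by (rule disintegration, rule measurable_compose[OF f measurable_surrogate[OF binary_loss]])
  also have "\<dots> = (\<integral>\<^sup>+x. ennreal (cond_risk (f x) x) \<partial>\<mu>)"
  proof (rule nn_integral_cong)
    fix x
    have "(\<Sum>y\<in>labels s. ennreal (\<eta> y x) * ennreal (surrogate s \<phi> y (f x))) =
        (\<Sum>y\<in>labels s. ennreal (\<eta> y x * surrogate s \<phi> y (f x)))"
      using \<eta>_nonneg by (simp add: ennreal_mult')
    also have "\<dots> = ennreal (\<Sum>y\<in>labels s. \<eta> y x * surrogate s \<phi> y (f x))"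
      using \<eta>_nonneg surrogate_nonneg[OF binary_loss]
      by (intro sum_ennreal mult_nonneg_nonneg) auto
    finally show "(\<Sum>y\<in>labels s. ennreal (\<eta> y x) * ennreal (surrogate s \<phi> y (f x))) =
        ennreal (cond_risk (f x) x)"
      by (simp only: cond_risk_eq)
  qed
  finally show ?thesis .
qed

lemma measurable_cond_risk:
  assumes "f \<in> X \<rightarrow>\<^sub>M scores s"
  shows "(\<lambda>x. cond_risk (f x) x) \<in> borel_measurable X"
  unfolding cond_risk_def
proof (intro borel_measurable_sum)
  fix i assume "i \<in> coords s"
  then show "(\<lambda>x. bin_risk \<phi> (q i x) (coord (f x) i)) \<in> borel_measurable X"
    by (intro measurable_bin_risk[OF binary_loss measurable_q]
        measurable_compose[OF assms measurable_coord])
qed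

lemma cond_risk_nonneg: "0 \<le> cond_risk u x"
  unfolding cond_risk_def by (intro sum_nonneg bin_risk_nonneg[OF binary_loss] q_01)

text \<open>Phrased through risks instead of the distance between \<open>link_inv\<close> and
  \<open>q\<close>: measurability then follows from that of the loss, and the inequality is exactly
  the gain available to a competitor.\<close>

definition improvable :: "real set \<Rightarrow> real \<Rightarrow> ('x \<Rightarrow> score) \<Rightarrow> 'x set" where
  "improvable V \<delta> f = {x \<in> space X. \<exists>i\<in>coords s. \<exists>v\<in>V.
     bin_risk \<phi> (q i x) v + \<delta> \<le> bin_risk \<phi> (q i x) (coord (f x) i)}"

lemma improvable_sets:
  assumes f: "f \<in> X \<rightarrow>\<^sub>M scores s" and "finite V"
  shows "improvable V \<delta> f \<in> sets X"
proof -
  have "{x \<in> space X. bin_risk \<phi> (q i x) v + \<delta> \<le> bin_risk \<phi> (q i x) (coord (f x) i)} \<in> sets X"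
    if "i \<in> coords s" for i v
  proof -
    have [measurable]: "(\<lambda>x. bin_risk \<phi> (q i x) v) \<in> borel_measurable X"
      by (intro measurable_bin_risk[OF binary_loss measurable_q]) simp
    have [measurable]: "(\<lambda>x. bin_risk \<phi> (q i x) (coord (f x) i)) \<in> borel_measurable X"
      by (intro measurable_bin_risk[OF binary_loss measurable_q]
          measurable_compose[OF f measurable_coord] that)
    show ?thesis by measurable
  qed
  then have "(\<Union>i\<in>coords s. \<Union>v\<in>V. {x \<in> space X. bin_risk \<phi> (q i x) v + \<delta> \<le>
      bin_risk \<phi> (q i x) (coord (f x) i)}) \<in> sets X"
    using assms(2) by (intro sets.finite_UN) auto
  also have "(\<Union>i\<in>coords s. \<Union>v\<in>V. {x \<in> space X. bin_risk \<phi> (q i x) v + \<delta> \<le>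
      bin_risk \<phi> (q i x) (coord (f x) i)}) = improvable V \<delta> f"
    by (auto simp: improvable_def)
  finally show ?thesis .
qed

text \<open>A competitor improved in every coordinate by \<open>measurable_improvement\<close> is
  nowhere worse than \<open>f\<close> and gains \<open>\<delta>\<close> on the improvable set;
  integration gives the bound.\<close>

lemma surrogate_regret_ge:
  assumes f: "f \<in> X \<rightarrow>\<^sub>M scores s" and V: "finite V" and "\<delta> > 0"
  shows "ennreal \<delta> * emeasure \<mu> (improvable V \<delta> f) \<le>
     surrogate_regret X (scores s) D (surrogate s \<phi>) f"
proof -
  define S where "S = improvable V \<delta> f"
  have S: "S \<in> sets \<mu>" using improvable_sets[OF f V] by (simp add: S_def sets_\<mu>)
  have "\<exists>g\<in>borel_measurable X. \<forall>x. bin_risk \<phi> (q i x) (g x) \<le> bin_risk \<phi> (q i x) (coord (f x) i) \<and>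
      (\<forall>v\<in>V. bin_risk \<phi> (q i x) (g x) \<le> bin_risk \<phi> (q i x) v)" if "i \<in> coords s" for i
    by (rule measurable_improvement[OF binary_loss V measurable_q[of i]
          measurable_compose[OF f measurable_coord[OF that]]]) blast
  then obtain g where g: "\<And>i. i \<in> coords s \<Longrightarrow> g i \<in> borel_measurable X"
    "\<And>i x. i \<in> coords s \<Longrightarrow> bin_risk \<phi> (q i x) (g i x) \<le> bin_risk \<phi> (q i x) (coord (f x) i)"
    "\<And>i x v. i \<in> coords s \<Longrightarrow> v \<in> V \<Longrightarrow> bin_risk \<phi> (q i x) (g i x) \<le> bin_risk \<phi> (q i x) v"
    by metis
  define f' where "f' x = (g None x, \<lambda>jk\<in>{1..s} \<times> {1..s}. g (Some jk) x)" for x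
  have f': "f' \<in> X \<rightarrow>\<^sub>M scores s"
    unfolding f'_def using g(1) by (rule measurable_score)
  have coord_f': "coord (f' x) i = g i x" if "i \<in> coords s" for i x
    using that by (auto simp: coords_def coord_def f'_def)
  have le: "cond_risk (f' x) x + \<delta> * indicator S x \<le> cond_risk (f x) x" for x
  proof (cases "x \<in> S")
    case True
    then obtain i v where i: "i \<in> coords s" and v: "v \<in> V"
      "bin_risk \<phi> (q i x) v + \<delta> \<le> bin_risk \<phi> (q i x) (coord (f x) i)"
      by (auto simp: S_def improvable_def)
    \<comment> \<open>Coordinate \<open>i\<close> gains \<open>\<delta>\<close> while the others do
      not lose.\<close>
    have "bin_risk \<phi> (q i x) (g i x) + \<delta> \<le> bin_risk \<phi> (q i x) (coord (f x) i)"
      using g(3)[OF i v(1), of x] v(2) by simp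
    moreover have "(\<Sum>i\<in>coords s - {i}. bin_risk \<phi> (q i x) (g i x)) \<le>
        (\<Sum>i\<in>coords s - {i}. bin_risk \<phi> (q i x) (coord (f x) i))"
      using g(2) by (intro sum_mono) auto
    ultimately show ?thesis
      using True i unfolding cond_risk_def
      by (simp add: sum.remove[OF finite_coords i] coord_f')
  next
    case False
    have "cond_risk (f' x) x \<le> cond_risk (f x) x"
      unfolding cond_risk_def using g(2) by (intro sum_mono) (simp add: coord_f')
    then show ?thesis using False by simp
  qed
  have "surrogate_er D (surrogate s \<phi>) f' + ennreal \<delta> * emeasure \<mu> S =
      (\<integral>\<^sup>+x. ennreal (cond_risk (f' x) x) + ennreal \<delta> * indicator S x \<partial>\<mu>)"
    unfolding surrogate_er_eq[OF f'] using S
    by (subst nn_integral_add)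
      (auto simp: nn_integral_cmult_indicator intro!: measurable_\<mu> measurable_cond_risk[OF f']
        measurable_compose[OF _ measurable_ennreal])
  also have "\<dots> \<le> (\<integral>\<^sup>+x. ennreal (cond_risk (f x) x) \<partial>\<mu>)"
  proof (rule nn_integral_mono)
    fix x
    have "ennreal (cond_risk (f' x) x) + ennreal \<delta> * indicator S x =
        ennreal (cond_risk (f' x) x + \<delta> * indicator S x)"
      using \<open>\<delta> > 0\<close> cond_risk_nonneg by (auto simp: indicator_def)
    then show "ennreal (cond_risk (f' x) x) + ennreal \<delta> * indicator S x \<le> ennreal (cond_risk (f x) x)"
      using le[of x] by (simp add: ennreal_leI)
  qed
  also have "\<dots> = surrogate_er D (surrogate s \<phi>) f"
    by (rule surrogate_er_eq[OF f, symmetric])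
  finally have er: "surrogate_er D (surrogate s \<phi>) f' + ennreal \<delta> * emeasure \<mu> S \<le>
      surrogate_er D (surrogate s \<phi>) f" .
  let ?I = "INF f'\<in>X \<rightarrow>\<^sub>M scores s. surrogate_er D (surrogate s \<phi>) f'"
  have I: "?I \<le> surrogate_er D (surrogate s \<phi>) f'" using f' by (rule INF_lower)
  have sum_le: "?I + ennreal \<delta> * emeasure \<mu> S \<le> surrogate_er D (surrogate s \<phi>) f"
    using add_right_mono[OF I] er by (rule order_trans)
  show ?thesis
  \<comment> \<open>Cancelling \<open>?I\<close> in \<open>ennreal\<close> requires it to be finite.
    If it is infinite, so is the error of \<open>f\<close>, and the regret is \<open>\<top>\<close>
    by the convention \<open>\<top> - \<top> = \<top>\<close>.\<close>
  proof (cases "?I = \<top>")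
    case True
    with sum_le have "surrogate_er D (surrogate s \<phi>) f = \<top>" by (simp add: top_unique)
    then show ?thesis unfolding surrogate_regret_def by simp
  next
    case False
    have "ennreal \<delta> * emeasure \<mu> S = ?I + ennreal \<delta> * emeasure \<mu> S - ?I"
      using False by simp
    also have "\<dots> \<le> surrogate_er D (surrogate s \<phi>) f - ?I"
      using sum_le by (rule ennreal_minus_mono) simp
    finally show ?thesis unfolding surrogate_regret_def S_def .
  qed
qed

section \<open>The conditional target loss\<close>

definition cond_loss :: "(nat \<Rightarrow> nat) \<Rightarrow> 'x \<Rightarrow> real" where
  "cond_loss z x = (\<Sum>y\<in>labels s. \<eta> y x * F_loss s \<beta> y z)"

text \<open>Linearity in \<open>coef_a\<close> carries over to the mean. Up to the constant 1 this
  is the decoding objective with the true \<open>q i x\<close> in place of the estimates.\<close>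

lemma cond_loss_eq: "cond_loss z x = 1 + (\<Sum>i\<in>coords s. coef_b s \<beta> z i * q i x)"
proof -
  have "cond_loss z x = (\<Sum>y\<in>labels s. \<eta> y x + (\<Sum>i\<in>coords s. \<eta> y x * (coef_a s y i * coef_b s \<beta> z i)))"
    unfolding cond_loss_def
    by (intro sum.cong) (auto simp: F_loss_coords[OF \<beta>_pos] distrib_left sum_distrib_left)
  also have "\<dots> = 1 + (\<Sum>i\<in>coords s. \<Sum>y\<in>labels s. \<eta> y x * (coef_a s y i * coef_b s \<beta> z i))"
    by (subst sum.swap) (simp add: sum.distrib \<eta>_sum)
  also have "\<dots> = 1 + (\<Sum>i\<in>coords s. coef_b s \<beta> z i * q i x)"
    by (simp add: q_def sum_distrib_left mult_ac)
  finally show ?thesis .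
qed

lemma cond_loss_01: 
  assumes "z \<in> labels s"
  shows "cond_loss z x \<in> {0..1}"
proof -
  have "cond_loss z x \<le> (\<Sum>y\<in>labels s. \<eta> y x * 1)"
    unfolding cond_loss_def using F_loss_01[OF _ assms] \<eta>_nonneg
    by (intro sum_mono mult_left_mono) auto
  moreover have "0 \<le> cond_loss z x"
    unfolding cond_loss_def using F_loss_01[OF _ assms] \<eta>_nonneg
    by (intro sum_nonneg mult_nonneg_nonneg) auto
  ultimately show ?thesis by (simp add: \<eta>_sum)
qed

lemma loss_er_eq:
  assumes h: "h \<in> X \<rightarrow>\<^sub>M count_space (labels s)"
  shows "integrable \<mu> (\<lambda>x. cond_loss (h x) x)"
    and "loss_er D (F_loss s \<beta>) h = (\<integral>x. cond_loss (h x) x \<partial>\<mu>)"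
proof -
  have h_lab: "h x \<in> labels s" if "x \<in> space X" for x
    using measurable_space[OF h that] by simp
  have F: "(\<lambda>x. F_loss s \<beta> y (h x)) \<in> borel_measurable X" for y
    by (rule measurable_compose[OF h]) simp
  have m: "(\<lambda>x. cond_loss (h x) x) \<in> borel_measurable \<mu>"
    unfolding cond_loss_def
    using \<eta>_measurable F by (intro measurable_\<mu> borel_measurable_sum borel_measurable_times)
  show "integrable \<mu> (\<lambda>x. cond_loss (h x) x)"
    using m cond_loss_01[OF h_lab]
    by (intro integrable_const_bound[of _ 1] AE_I2) (auto simp: space_\<mu>)
  have D_space: "space D = space X \<times> labels s"
    using sets_eq_imp_space_eq[OF sets_D] by (simp add: space_pair_measure)
  have "(\<lambda>(x, y). F_loss s \<beta> y (h x)) \<in> borel_measurable D"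
    unfolding measurable_cong_sets[OF sets_D refl]
    using F by (rule measurable_prod_count_space[OF finite_labels])
  \<comment> \<open>Disintegration is stated for nonnegative integrals, so the Bochner integral is
    converted there and back; losses in \<open>{0..1}\<close> allow this.\<close>
  then have "loss_er D (F_loss s \<beta>) h = enn2real (\<integral>\<^sup>+z. ennreal (case z of (x, y) \<Rightarrow> F_loss s \<beta> y (h x)) \<partial>D)"
    unfolding loss_er_def using F_loss_01[OF _ h_lab]
    by (intro integral_eq_nn_integral AE_I2) (auto simp: D_space)
  also have "(\<integral>\<^sup>+z. ennreal (case z of (x, y) \<Rightarrow> F_loss s \<beta> y (h x)) \<partial>D) =
      (\<integral>\<^sup>+(x, y). ennreal (F_loss s \<beta> y (h x)) \<partial>D)"
    by (simp add: case_prod_beta')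
  also have "\<dots> = (\<integral>\<^sup>+x. (\<Sum>y\<in>labels s. ennreal (\<eta> y x) * ennreal (F_loss s \<beta> y (h x))) \<partial>\<mu>)"
    by (rule disintegration[OF F])
  also have "\<dots> = (\<integral>\<^sup>+x. ennreal (cond_loss (h x) x) \<partial>\<mu>)"
  proof (rule nn_integral_cong)
    fix x assume "x \<in> space \<mu>"
    then have "h x \<in> labels s" using h_lab by (simp add: space_\<mu>)
    have "(\<Sum>y\<in>labels s. ennreal (\<eta> y x) * ennreal (F_loss s \<beta> y (h x))) =
        (\<Sum>y\<in>labels s. ennreal (\<eta> y x * F_loss s \<beta> y (h x)))"
      using \<eta>_nonneg by (simp add: ennreal_mult')
    also have "\<dots> = ennreal (cond_loss (h x) x)"
      unfolding cond_loss_def using \<eta>_nonneg F_loss_01[OF _ \<open>h x \<in> labels s\<close>]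
      by (intro sum_ennreal mult_nonneg_nonneg) auto
    finally show "(\<Sum>y\<in>labels s. ennreal (\<eta> y x) * ennreal (F_loss s \<beta> y (h x))) = \<dots>" .
  qed
  also have "enn2real \<dots> = (\<integral>x. cond_loss (h x) x \<partial>\<mu>)"
    using m cond_loss_01[OF h_lab]
    by (intro integral_eq_nn_integral[symmetric] AE_I2) (auto simp: space_\<mu>)
  finally show "loss_er D (F_loss s \<beta>) h = (\<integral>x. cond_loss (h x) x \<partial>\<mu>)" .
qed

lemma loss_er_nonneg:
  assumes "h \<in> X \<rightarrow>\<^sub>M count_space (labels s)"
  shows "0 \<le> loss_er D (F_loss s \<beta>) h"
  unfolding loss_er_eq(2)[OF assms]
  using cond_loss_01 measurable_space[OF assms]
  by (intro Bochner_Integration.integral_nonneg_AE AE_I2) (auto simp: space_\<mu>)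

text \<open>The infimum is taken over reals, so it is a lower bound because the errors are bounded
  below, here by 0.\<close>

lemma loss_regret_nonneg:
  assumes "h \<in> X \<rightarrow>\<^sub>M count_space (labels s)"
  shows "0 \<le> loss_regret X (labels s) D (F_loss s \<beta>) h"
  unfolding loss_regret_def using assms loss_er_nonneg
  by (auto intro!: cINF_lower bdd_belowI2)

section \<open>From estimation error to target regret\<close>

lemma measurable_dec: "f \<in> X \<rightarrow>\<^sub>M scores s \<Longrightarrow> dec \<circ> f \<in> X \<rightarrow>\<^sub>M count_space (labels s)"
  using dec by (auto simp: is_decoding_def intro: measurable_comp)

text \<open>Twice the bound on a single coefficient, times the number of coordinates: the rate at
  which errors in the estimated probabilities turn into decoding loss.\<close>

definition B :: real where
  "B = 2 * ((1 + \<beta>\<^sup>2) / \<beta>\<^sup>2) * card (coords s)"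

lemma B_pos: "B > 0"
  using \<beta>_pos coords_nonempty[of s]
  by (auto simp: B_def card_gt_0_iff intro!: mult_pos_pos divide_pos_pos add_pos_pos)

text \<open>Plug-in argument: \<open>dec u\<close> is optimal for the estimates \<open>p\<close>,
  and passing from \<open>p\<close> to \<open>q\<close> changes the comparison with \<open>z\<close>
  by coefficient differences times estimation errors.\<close>

lemma cond_loss_dec:
  assumes u: "u \<in> space (scores s)" and z: "z \<in> labels s"
    and near: "\<And>i. i \<in> coords s \<Longrightarrow> \<bar>link_inv \<gamma> (coord u i) - q i x\<bar> \<le> \<epsilon>"
  shows "cond_loss (dec u) x \<le> cond_loss z x + B * \<epsilon>"
proof -
  define p where "p i = link_inv \<gamma> (coord u i)" for i
  let ?b = "coef_b s \<beta>"
  have am: "is_arg_min (decode_objective s \<beta> \<gamma> u) (\<lambda>z. z \<in> labels s) (dec u)"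
    using dec u by (simp add: is_decoding_def)
  then have d: "dec u \<in> labels s" by (simp add: is_arg_min_def)
  have "decode_objective s \<beta> \<gamma> u (dec u) \<le> decode_objective s \<beta> \<gamma> u z"
    using am z by (auto simp: is_arg_min_def not_less)
  then have "(\<Sum>i\<in>coords s. ?b (dec u) i * p i) \<le> (\<Sum>i\<in>coords s. ?b z i * p i)"
    by (simp add: decode_objective_coords p_def)
  \<comment> \<open>The added bracket is nonnegative by optimality of \<open>dec u\<close>; with it
    the right side becomes a sum of products containing the errors
    \<open>p i - q i x\<close>.\<close>
  then have "cond_loss (dec u) x - cond_loss z x \<le>
      (\<Sum>i\<in>coords s. ?b (dec u) i * q i x) - (\<Sum>i\<in>coords s. ?b z i * q i x)
      + ((\<Sum>i\<in>coords s. ?b z i * p i) - (\<Sum>i\<in>coords s. ?b (dec u) i * p i))"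
    by (simp add: cond_loss_eq)
  also have "\<dots> = (\<Sum>i\<in>coords s. (?b z i - ?b (dec u) i) * (p i - q i x))"
    by (simp add: sum_subtractf[symmetric] sum.distrib[symmetric] algebra_simps)
  also have "\<dots> \<le> (\<Sum>i\<in>coords s. 2 * ((1 + \<beta>\<^sup>2) / \<beta>\<^sup>2) * \<epsilon>)"
  proof (rule sum_mono)
    fix i assume i: "i \<in> coords s"
    have "\<bar>?b z i - ?b (dec u) i\<bar> \<le> 2 * ((1 + \<beta>\<^sup>2) / \<beta>\<^sup>2)"
      using coef_b_bound[OF \<beta>_pos z i] coef_b_bound[OF \<beta>_pos d i] by linarith
    then have "\<bar>(?b z i - ?b (dec u) i) * (p i - q i x)\<bar> \<le> 2 * ((1 + \<beta>\<^sup>2) / \<beta>\<^sup>2) * \<epsilon>"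
      unfolding abs_mult using near[OF i] by (intro mult_mono) (auto simp: p_def)
    then show "(?b z i - ?b (dec u) i) * (p i - q i x) \<le> 2 * ((1 + \<beta>\<^sup>2) / \<beta>\<^sup>2) * \<epsilon>"
      by linarith
  qed
  also have "\<dots> = B * \<epsilon>" by (simp add: B_def)
  finally show ?thesis by simp
qed

text \<open>Small surrogate regret forces the badly estimated instances to have small mass, and
  elsewhere decoding is nearly optimal. The threshold must not depend on \<open>f\<close> for use
  with convergence in probability.\<close>

lemma regret_transfer:
  assumes "\<epsilon> > 0"
  obtains \<delta> where "\<delta> > 0"
    "\<And>f. f \<in> X \<rightarrow>\<^sub>M scores s \<Longrightarrow>
       surrogate_regret X (scores s) D (surrogate s \<phi>) f \<le> ennreal \<delta> \<Longrightarrow>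
       loss_regret X (labels s) D (F_loss s \<beta>) (dec \<circ> f) \<le> \<epsilon>"
proof -
  \<comment> \<open>The set \<open>S\<close> and the well estimated instances will each contribute
    at most \<open>B * \<epsilon>'\<close>, half of \<open>\<epsilon>\<close>.\<close>
  define \<epsilon>' where "\<epsilon>' = \<epsilon> / (2 * B)"
  have "\<epsilon>' > 0" using assms B_pos by (simp add: \<epsilon>'_def)
  obtain V \<delta> where V: "finite V" and "\<delta> > 0"
    and gap: "\<And>q u. q \<in> {0..1} \<Longrightarrow> \<epsilon>' \<le> \<bar>link_inv \<gamma> u - q\<bar> \<Longrightarrow>
      \<exists>v\<in>V. bin_risk \<phi> q v + \<delta> \<le> bin_risk \<phi> q u"
    by (fact uniform_gap[OF spc \<open>\<epsilon>' > 0\<close>])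
  show ?thesis
  proof
    \<comment> \<open>With this threshold \<open>surrogate_regret_ge\<close> bounds the mass of
      \<open>S\<close> by \<open>\<epsilon>'\<close> after division by
      \<open>\<delta>\<close>.\<close>
    show "\<delta> * \<epsilon>' > 0" using \<open>\<delta> > 0\<close> \<open>\<epsilon>' > 0\<close> by simp
    fix f
    assume f: "f \<in> X \<rightarrow>\<^sub>M scores s"
      and reg: "surrogate_regret X (scores s) D (surrogate s \<phi>) f \<le> ennreal (\<delta> * \<epsilon>')"
    define S where "S = improvable V \<delta> f"
    have S: "S \<in> sets \<mu>" using improvable_sets[OF f V] by (simp add: S_def sets_\<mu>)
    have "ennreal (\<delta> * measure \<mu> S) = ennreal \<delta> * emeasure \<mu> S"
      using \<open>\<delta> > 0\<close> by (simp add: emeasure_eq_measure ennreal_mult)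
    also have "\<dots> \<le> ennreal (\<delta> * \<epsilon>')"
      unfolding S_def using surrogate_regret_ge[OF f V \<open>\<delta> > 0\<close>] reg by (rule order_trans)
    finally have "\<delta> * measure \<mu> S \<le> \<delta> * \<epsilon>'"
      using \<open>\<delta> > 0\<close> \<open>\<epsilon>' > 0\<close> by (subst (asm) ennreal_le_iff) auto
    then have mS: "measure \<mu> S \<le> \<epsilon>'" using \<open>\<delta> > 0\<close> by simp
    have df: "dec \<circ> f \<in> X \<rightarrow>\<^sub>M count_space (labels s)" by (rule measurable_dec[OF f])
    have "loss_er D (F_loss s \<beta>) (dec \<circ> f) - \<epsilon> \<le> loss_er D (F_loss s \<beta>) h"
      if h: "h \<in> X \<rightarrow>\<^sub>M count_space (labels s)" for h
    proof -
      have pt: "cond_loss (dec (f x)) x \<le> cond_loss (h x) x + (B * \<epsilon>' + B * indicator S x)"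
        if x: "x \<in> space \<mu>" for x
      proof -
        have fx: "f x \<in> space (scores s)" and hx: "h x \<in> labels s"
          using measurable_space[OF f] measurable_space[OF h] x by (auto simp: space_\<mu>)
        show ?thesis
        proof (cases "x \<in> S")
          case True
          \<comment> \<open>Two numbers in the unit interval differ by at most 1, so
            \<open>cond_loss_dec\<close> with error 1 bounds the excess by \<open>B\<close>.\<close>
          have "\<bar>link_inv \<gamma> (coord (f x) i) - q i x\<bar> \<le> 1" if "i \<in> coords s" for i
            using q_01[OF that, of x] link_inv(1)[OF link, of "coord (f x) i"] by auto
          from cond_loss_dec[OF fx hx this]
          have "cond_loss (dec (f x)) x \<le> cond_loss (h x) x + B" by simp
          moreover have "0 \<le> B * \<epsilon>'" using B_pos \<open>\<epsilon>' > 0\<close> by simp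
          ultimately show ?thesis using True by simp
        next
          case False
          \<comment> \<open>A larger error would let some value in \<open>V\<close> improve
            coordinate \<open>i\<close> by \<open>\<delta>\<close>, which would put \<open>x\<close>
            into \<open>S\<close>.\<close>
          have "\<bar>link_inv \<gamma> (coord (f x) i) - q i x\<bar> \<le> \<epsilon>'" if i: "i \<in> coords s" for i
          proof (rule ccontr)
            assume "\<not> \<bar>link_inv \<gamma> (coord (f x) i) - q i x\<bar> \<le> \<epsilon>'"
            then have "\<exists>v\<in>V. bin_risk \<phi> (q i x) v + \<delta> \<le> bin_risk \<phi> (q i x) (coord (f x) i)"
              by (intro gap q_01[OF i]) simp
            then show False using False x i by (auto simp: S_def improvable_def space_\<mu>)
          qed
          from cond_loss_dec[OF fx hx this] show ?thesis using False by simp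
        qed
      qed
      have int_S: "integrable \<mu> (\<lambda>x. B * \<epsilon>' + B * indicator S x)"
        using S by (intro Bochner_Integration.integrable_add integrable_mult_right
            integrable_real_indicator) (auto simp: emeasure_eq_measure)
      have "loss_er D (F_loss s \<beta>) (dec \<circ> f) \<le>
          (\<integral>x. cond_loss (h x) x + (B * \<epsilon>' + B * indicator S x) \<partial>\<mu>)"
        unfolding loss_er_eq(2)[OF df]
        using loss_er_eq(1)[OF df] Bochner_Integration.integrable_add[OF loss_er_eq(1)[OF h] int_S]
        by (rule integral_mono) (simp add: pt)
      also have "\<dots> = loss_er D (F_loss s \<beta>) h + (B * \<epsilon>' + B * measure \<mu> S)"
        using loss_er_eq[OF h] int_S S by (simp add: prob_space emeasure_eq_measure)
      also have "B * \<epsilon>' + B * measure \<mu> S \<le> B * \<epsilon>' + B * \<epsilon>'"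
        using mS B_pos by simp
      also have "\<dots> = \<epsilon>" using B_pos by (simp add: \<epsilon>'_def)
      finally show ?thesis by (simp only: diff_le_eq add_left_mono)
    qed
    then have "loss_er D (F_loss s \<beta>) (dec \<circ> f) - \<epsilon> \<le>
        (INF h\<in>X \<rightarrow>\<^sub>M count_space (labels s). loss_er D (F_loss s \<beta>) h)"
      using df by (intro cINF_greatest) auto
    then show "loss_regret X (labels s) D (F_loss s \<beta>) (dec \<circ> f) \<le> \<epsilon>"
      by (simp add: loss_regret_def)
  qed
qed

end

section \<open>Convergence in probability\<close>

lemma prob_space_training_space:
  assumes "prob_space D" "prob_space R"
  shows "prob_space (training_space D R m)"
  unfolding training_space_def using assms by (intro prob_space_pair prob_space_PiM)

text \<open>Convergence in probability carries no information about non-measurable events, whose measure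
  is \<open>0\<close> by convention, so the surrogate regret must be measurable in the training sample.\<close>

lemma measurable_surrogate_er:
  assumes "prob_space D" and D: "sets D = sets (X \<Otimes>\<^sub>M count_space (labels s))"
    and "binary_loss \<phi>" and f: "(\<lambda>(w, x). f w x) \<in> W \<Otimes>\<^sub>M X \<rightarrow>\<^sub>M scores s"
  shows "(\<lambda>w. surrogate_er D (surrogate s \<phi>) (f w)) \<in> borel_measurable W"
proof -
  interpret prob_space D by fact
  let ?P = "W \<Otimes>\<^sub>M D" and ?Q = "(W \<Otimes>\<^sub>M X) \<Otimes>\<^sub>M count_space (labels s)"
  have sets_P: "sets ?P = sets (W \<Otimes>\<^sub>M (X \<Otimes>\<^sub>M count_space (labels s)))"
    using D by (intro sets_pair_measure_cong) auto
  \<comment> \<open>Reassociation makes the finite label space the last factor, where measurability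
    is checked label by label.\<close>
  have "(\<lambda>(w, x, y). ((w, x), y)) \<in> W \<Otimes>\<^sub>M (X \<Otimes>\<^sub>M count_space (labels s)) \<rightarrow>\<^sub>M ?Q"
    by measurable
  then have assoc: "(\<lambda>(w, x, y). ((w, x), y)) \<in> ?P \<rightarrow>\<^sub>M ?Q"
    unfolding measurable_cong_sets[OF sets_P refl] .
  have "(\<lambda>(wx, y). ennreal (surrogate s \<phi> y (f (fst wx) (snd wx)))) \<in> borel_measurable ?Q"
  proof (rule measurable_prod_count_space[OF finite_labels])
    fix y
    have "(\<lambda>wx. f (fst wx) (snd wx)) \<in> W \<Otimes>\<^sub>M X \<rightarrow>\<^sub>M scores s"
      using f by (simp add: case_prod_beta')
    from measurable_compose[OF this measurable_surrogate[OF assms(3)]]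
    show "(\<lambda>wx. ennreal (surrogate s \<phi> y (f (fst wx) (snd wx)))) \<in> borel_measurable (W \<Otimes>\<^sub>M X)"
      by (rule measurable_compose[OF _ measurable_ennreal])
  qed
  from measurable_compose[OF assoc this]
  have "(\<lambda>(w, z). case z of (x, y) \<Rightarrow> ennreal (surrogate s \<phi> y (f w x))) \<in> borel_measurable ?P"
    by (simp add: case_prod_beta')
  then show ?thesis
    unfolding surrogate_er_def by (rule borel_measurable_nn_integral)
qed

theorem mainTheorem3:
  fixes s :: nat and \<beta> :: real
    and \<phi> :: "int \<Rightarrow> real \<Rightarrow> real" and \<gamma> :: "real \<Rightarrow> ereal"
    and dec :: "score \<Rightarrow> nat \<Rightarrow> nat"
    and X :: "'x measure"
  assumes "s \<ge> 1" and "\<beta> > 0"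
    and "strictly_proper_composite \<phi> \<gamma>"
    and "is_decoding s \<beta> \<gamma> dec"
  shows "calibrated TYPE('r) X (labels s) (scores s) (F_loss s \<beta>) (surrogate s \<phi>) dec"
  unfolding calibrated_def
proof (intro allI impI)
  fix D :: "('x \<times> (nat \<Rightarrow> nat)) measure" and R :: "nat \<Rightarrow> 'r measure"
    and f :: "nat \<Rightarrow> (nat \<Rightarrow> 'x \<times> (nat \<Rightarrow> nat)) \<times> 'r \<Rightarrow> 'x \<Rightarrow> score"
  assume D: "prob_space D" "sets D = sets (X \<Otimes>\<^sub>M count_space (labels s))"
    and R: "\<forall>m. prob_space (R m)"
    and f: "\<forall>m. (\<lambda>(w, x). f m w x) \<in> training_space D (R m) m \<Otimes>\<^sub>M X \<rightarrow>\<^sub>M scores s"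
    and conv: "tendsto_zero_in_prob (\<lambda>m. training_space D (R m) m)
         (\<lambda>m w. enn2ereal (surrogate_regret X (scores s) D (surrogate s \<phi>) (f m w)))"
  let ?P = "\<lambda>m. training_space D (R m) m"
  let ?Z = "\<lambda>m w. surrogate_regret X (scores s) D (surrogate s \<phi>) (f m w)"
  let ?L = "\<lambda>m w. loss_regret X (labels s) D (F_loss s \<beta>) (dec \<circ> f m w)"
  \<comment> \<open>The conditional distribution is chosen once for \<open>D\<close>, before the
    sample, so that one threshold serves all learned models.\<close>
  obtain \<mu> \<eta> where \<mu>: "prob_space \<mu>" "sets \<mu> = sets X"
    "\<And>y. (\<eta> y :: 'x \<Rightarrow> real) \<in> borel_measurable X"
    "\<And>x y. 0 \<le> \<eta> y x" "\<And>x. (\<Sum>y\<in>labels s. \<eta> y x) = 1"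
    "\<And>g. (\<And>y. y \<in> labels s \<Longrightarrow> g y \<in> borel_measurable X) \<Longrightarrow>
       (\<integral>\<^sup>+(x, y). ennreal (g y x) \<partial>D) =
       (\<integral>\<^sup>+x. (\<Sum>y\<in>labels s. ennreal (\<eta> y x) * ennreal (g y x)) \<partial>\<mu>)"
    by (fact conditional_probabilities[OF D finite_labels])
  interpret \<mu>: prob_space \<mu> by fact
  interpret label_model \<mu> X D \<eta> s \<beta> \<phi> \<gamma> dec
    by unfold_locales (use \<mu> D assms in auto)
  have fw: "f m w \<in> X \<rightarrow>\<^sub>M scores s" if "w \<in> space (?P m)" for m w
    using measurable_compose[OF measurable_Pair1'[OF that] spec[OF f, of m]] by simp
  show "tendsto_zero_in_prob ?P (\<lambda>m w. ereal (?L m w))"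
    unfolding tendsto_zero_in_prob_def
  proof (intro allI impI)
    fix \<epsilon> :: real assume "\<epsilon> > 0"
    obtain \<delta> where \<delta>: "\<delta> > 0"
      "\<And>f. f \<in> X \<rightarrow>\<^sub>M scores s \<Longrightarrow>
         surrogate_regret X (scores s) D (surrogate s \<phi>) f \<le> ennreal \<delta> \<Longrightarrow>
         loss_regret X (labels s) D (F_loss s \<beta>) (dec \<circ> f) \<le> \<epsilon>"
      by (fact regret_transfer[OF \<open>\<epsilon> > 0\<close>])
    have ge_iff: "\<bar>enn2ereal c\<bar> > ereal \<delta> \<longleftrightarrow> ennreal \<delta> < c" for c
      using \<delta>(1) by (simp add: less_ennreal.rep_eq)
    have lim: "(\<lambda>m. measure (?P m) {w \<in> space (?P m). ennreal \<delta> < ?Z m w}) \<longlonglongrightarrow> 0"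
      using conv[unfolded tendsto_zero_in_prob_def, rule_format, OF \<delta>(1)] unfolding ge_iff .
    have bound: "measure (?P m) {w \<in> space (?P m). \<bar>ereal (?L m w)\<bar> > ereal \<epsilon>} \<le>
        measure (?P m) {w \<in> space (?P m). ennreal \<delta> < ?Z m w}" for m
    proof -
      interpret P: prob_space "?P m" using D(1) R by (intro prob_space_training_space) auto
      have [measurable]: "(\<lambda>w. surrogate_er D (surrogate s \<phi>) (f m w)) \<in> borel_measurable (?P m)"
        using D binary_loss spec[OF f, of m] by (rule measurable_surrogate_er)
      show ?thesis
      \<comment> \<open>Monotonicity asks for measurability of the larger event, the one about the
        surrogate regret.\<close>
      proof (rule P.finite_measure_mono)
        show "{w \<in> space (?P m). \<bar>ereal (?L m w)\<bar> > ereal \<epsilon>} \<subseteq> {w \<in> space (?P m). ennreal \<delta> < ?Z m w}"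
        proof safe
          fix w assume w: "w \<in> space (?P m)" and gt: "\<bar>ereal (?L m w)\<bar> > ereal \<epsilon>"
          \<comment> \<open>Nonnegativity of the target regret removes the absolute value.\<close>
          have "?L m w > \<epsilon>"
            using gt loss_regret_nonneg[OF measurable_dec[OF fw[OF w]]] by simp
          then show "ennreal \<delta> < ?Z m w" using \<delta>(2)[OF fw[OF w]] by (meson not_le)
        qed
        show "{w \<in> space (?P m). ennreal \<delta> < ?Z m w} \<in> P.events"
          unfolding surrogate_regret_def by measurable
      qed
    qed
    show "(\<lambda>m. measure (?P m) {w \<in> space (?P m). \<bar>ereal (?L m w)\<bar> > ereal \<epsilon>}) \<longlonglongrightarrow> 0"
      by (rule tendsto_sandwich[OF _ _ tendsto_const lim]) (use bound in auto)
  qed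
qed

end
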